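(* Algorithm Agr, described below, is a $(4(2-\frac{1}{m}))^{\alpha-1}$-approximation algorithm for the problem of minimizing energy of a feasible non-preemptive schedule on $m\ge1$ speed-scalable processors for agreeable instances. Algorithm Agr: (1) partition the jobs as follows: $T_1=\min\{d_j: J_j\in\mathcal{J}\}$, $\mathcal{J}_1=\{J_j: r_j\le T_1\}$; for $\ell\ge 2$, $T_\ell=\min\{d_j: J_j\in\mathcal{J}\setminus(\mathcal{J}_1\cup\dots\cup\mathcal{J}_{\ell-1})\}$ and $\mathcal{J}_\ell=\{J_j: T_{\ell-1}<r_j\le T_\ell\}$, continuing until every job is assigned; let $k$ be the number of sets. (2) For each $\ell=1,\dots,k$, form the instance $\mathcal{I}_\ell$ consisting of the jobs of $\mathcal{J}_\ell$, where job $J_j$ keeps its work $w_j$ and gets release date $r_j+\frac{T_\ell-r_j}{2}$ and deadline $d_j-\frac{d_j-T_\ell}{2}$; apply algorithm Cl to $\mathcal{I}_\ell$. (3) Return the union of the $k$ non-preemptive schedules. Algorithm Cl (for a clique instance): compute an optimal preemptive schedule with migration $\mathcal{S}_{pr}$; let $T=\min_j d_j$ and let $e_{\ell j}$, $e_{rj}$ be the total execution times of $J_j$ in $\mathcal{S}_{pr}$ before and after $T$; let $\mathbb{L}=\{J_j: e_{\ell j}\ge e_{rj}\}$, $\mathbb{R}=\{J_j: e_{\ell j}<e_{rj}\}$; apply algorithm CD to the jobs of $\mathbb{L}$ with original works and release dates and all deadlines set to $T$, and algorithm CRD to the jobs of $\mathbb{R}$ with original works and deadlines and all release dates set to $T$;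 return the union of the two schedules. Algorithm CRD (for a common release date $R$): compute an optimal preemptive schedule with migration, let $e_j$ be the total execution time of $J_j$ in it, set $p_j=e_j/(2-\frac1m)$, and starting at time $R$ schedule jobs non-preemptively by Earliest Deadline First (whenever a processor becomes idle, start on it the unscheduled job with smallest deadline), each job run at constant speed $w_j/p_j$. Algorithm CD (for a common deadline $D$): same $p_j$, but schedule backwards from $D$ by Latest Release Date First (going backwards from $D$, whenever a processor becomes free, place on it the unscheduled job with largest release date so that it completes at that time), each job run at speed $w_j/p_j$.
   Context: There are $m$ identical processors, each able to run at a variable speed; running at speed $s$ consumes power $s^{\alpha}$, where $\alpha>1$ is a constant; energy is power integrated over time, so a job of work $w$ run at constant speed $s$ consumes energy $w s^{\alpha-1}$. A job $J_j$ has work $w_j>0$, release date $r_j$ and deadline $d_j>r_j$. An instance is agreeable if for any two jobs $J_j,J_{j'}$ with $r_j\le r_{j'}$ we have $d_j\le d_{j'}$. A feasible non-preemptive schedule assigns each job to a single processor and executes it without interruption during a time interval contained in $[r_j,d_j]$, processing exactly $w_j$ units of work (work is the integral of speed), with each processor executing at most one job at a time. A preemptive schedule with migration may interrupt a job and resume it later, possibly on a different processor, but never runs a job on two processors at the same time, and each job's work must be processed within $[r_j,d_j]$. An optimal preemptive schedule with migration can be computed in polynomial time (known result). A $\rho$-approximation algorithm is a polynomial-time algorithm returning a feasible non-preemptive schedule of total energy at most $\rho$ times the minimum energy of a feasible non-preemptive schedule for the same instance. *)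

theory Defs
  imports
    "HOL-Analysis.Analysis"
    "HOL-Computational_Algebra.Polynomial"
    "HOL-Library.Log_Nat"
    "HOL-Library.Time_Functions"
begin

section \<open>Instances\<close>

text \<open>Jobs carry an identifier, so that a job whose release date or deadline has been modified by an
  algorithm is still the same job in a schedule.\<close>

datatype job = Job (jid: nat) (work: real) (release: real) (deadline: real)

definition valid_instance :: "job list \<Rightarrow> bool" where
  "valid_instance js \<longleftrightarrow>
     distinct (map jid js) \<and> (\<forall>j\<in>set js. 0 < work j \<and> release j < deadline j)"

definition agreeable :: "job list \<Rightarrow> bool" where
  "agreeable js \<longleftrightarrow>
     (\<forall>j\<in>set js. \<forall>j'\<in>set js. release j \<le> release j' \<longrightarrow> deadline j \<le> deadline j')"

section \<open>Schedules\<close>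

text \<open>At time \<open>t\<close> processor \<open>i\<close> executes the job with identifier \<open>run S i t\<close> (or is idle) at speed
  \<open>speed S i t\<close>; only the processors \<open>i < m\<close> matter.  Since \<open>run S i\<close> is a function of time, a
  processor executes at most one job at a time.\<close>

record schedule =
  run :: "nat \<Rightarrow> real \<Rightarrow> nat option"
  speed :: "nat \<Rightarrow> real \<Rightarrow> real"

definition energy :: "real \<Rightarrow> nat \<Rightarrow> schedule \<Rightarrow> ennreal" where
  "energy \<alpha> m S = (\<Sum>i<m. \<integral>\<^sup>+ t. ennreal (speed S i t powr \<alpha>) \<partial>lborel)"

definition work_done :: "nat \<Rightarrow> schedule \<Rightarrow> nat \<Rightarrow> ennreal" where
  "work_done m S k =
     (\<Sum>i<m. \<integral>\<^sup>+ t\<in>{t. run S i t = Some k}. ennreal (speed S i t) \<partial>lborel)"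

text \<open>Feasible preemptive schedules with migration.\<close>

definition preemptive_feasible :: "nat \<Rightarrow> job list \<Rightarrow> schedule \<Rightarrow> bool" where
  "preemptive_feasible m js S \<longleftrightarrow>
     (\<forall>i<m. speed S i \<in> borel_measurable borel \<and> (\<forall>k. {t. run S i t = Some k} \<in> sets borel)) \<and>
     (\<forall>i<m. \<forall>t. 0 \<le> speed S i t \<and> (run S i t = None \<longrightarrow> speed S i t = 0)) \<and>
     (\<forall>i<m. \<forall>t k. run S i t = Some k \<longrightarrow>
        (\<exists>j\<in>set js. jid j = k \<and> release j \<le> t \<and> t \<le> deadline j)) \<and>
     (\<forall>i<m. \<forall>i'<m. \<forall>t k. run S i t = Some k \<and> run S i' t = Some k \<longrightarrow> i = i') \<and>
     (\<forall>j\<in>set js. work_done m S (jid j) = ennreal (work j))"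

text \<open>Non-preemptive schedules: moreover, every job occupies one processor during one time interval
  (taken half-open, so that consecutive jobs may touch).\<close>

definition nonpreemptive_feasible :: "nat \<Rightarrow> job list \<Rightarrow> schedule \<Rightarrow> bool" where
  "nonpreemptive_feasible m js S \<longleftrightarrow>
     preemptive_feasible m js S \<and>
     (\<forall>j\<in>set js. \<exists>i<m. \<exists>a b. \<forall>i'<m. \<forall>t.
        run S i' t = Some (jid j) \<longleftrightarrow> i' = i \<and> a \<le> t \<and> t < b)"

definition optimal_preemptive :: "real \<Rightarrow> nat \<Rightarrow> job list \<Rightarrow> schedule \<Rightarrow> bool" where
  "optimal_preemptive \<alpha> m js S \<longleftrightarrow>
     preemptive_feasible m js S \<and>
     (\<forall>S'. preemptive_feasible m js S' \<longrightarrow> energy \<alpha> m S \<le> energy \<alpha> m S')"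

definition nonpreemptive_opt :: "real \<Rightarrow> nat \<Rightarrow> job list \<Rightarrow> ennreal" where
  "nonpreemptive_opt \<alpha> m js = (INF S\<in>{S. nonpreemptive_feasible m js S}. energy \<alpha> m S)"

section \<open>Finite representation of schedules\<close>

text \<open>The data that algorithms compute: lists of pieces, each running one job on one processor at
  constant speed during \<open>[seg_start, seg_end)\<close>.\<close>

datatype segment =
  Seg (seg_job: nat) (seg_proc: nat) (seg_start: real) (seg_end: real) (seg_speed: real)

text \<open>Pieces on the same processor must not overlap; without this condition \<open>schedule_of\<close> would
  silently drop parts of pieces.\<close>

definition wf_segments :: "nat \<Rightarrow> segment list \<Rightarrow> bool" where
  "wf_segments m ss \<longleftrightarrow>
     (\<forall>s\<in>set ss. seg_proc s < m \<and> seg_start s < seg_end s) \<and>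
     sorted_wrt (\<lambda>s s'. seg_proc s = seg_proc s' \<longrightarrow>
        seg_end s \<le> seg_start s' \<or> seg_end s' \<le> seg_start s) ss"

definition active :: "segment list \<Rightarrow> nat \<Rightarrow> real \<Rightarrow> segment option" where
  "active ss i t = find (\<lambda>s. seg_proc s = i \<and> seg_start s \<le> t \<and> t < seg_end s) ss"

definition schedule_of :: "segment list \<Rightarrow> schedule" where
  "schedule_of ss =
     \<lparr>run = (\<lambda>i t. map_option seg_job (active ss i t)),
      speed = (\<lambda>i t. case active ss i t of None \<Rightarrow> 0 | Some s \<Rightarrow> seg_speed s)\<rparr>"

section \<open>The algorithms\<close>

text \<open>The parameter \<open>opt\<close> is the subroutine computing optimal preemptive schedules with migration.
  Ties between jobs are broken by their order in the instance, as \<open>sort_key\<close> is stable; since this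
  order is arbitrary, all tie-breaking rules given by an order of the jobs are covered.\<close>

definition exec_time :: "segment list \<Rightarrow> nat \<Rightarrow> real" where
  "exec_time ss k = (\<Sum>s\<leftarrow>ss. if seg_job s = k then seg_end s - seg_start s else 0)"

definition exec_before :: "real \<Rightarrow> segment list \<Rightarrow> nat \<Rightarrow> real" where
  "exec_before T ss k =
     (\<Sum>s\<leftarrow>ss. if seg_job s = k then max 0 (min (seg_end s) T - seg_start s) else 0)"

definition exec_after :: "real \<Rightarrow> segment list \<Rightarrow> nat \<Rightarrow> real" where
  "exec_after T ss k =
     (\<Sum>s\<leftarrow>ss. if seg_job s = k then max 0 (seg_end s - max (seg_start s) T) else 0)"

definition proc_times ::
  "(nat \<Rightarrow> job list \<Rightarrow> segment list) \<Rightarrow> nat \<Rightarrow> job list \<Rightarrow> (job \<times> real) list" where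
  "proc_times opt m js =
     (let S = opt m js in map (\<lambda>j. (j, exec_time S (jid j) / (2 - 1 / real m))) js)"

text \<open>The state \<open>ps\<close> of the list schedulers holds, for every processor, the time at which it becomes
  idle (for \<open>backward\<close>: the time before which it is free).  Placing the first unscheduled job on the
  processor with the smallest (for \<open>backward\<close>: largest) such time is the same as letting every
  processor take the first unscheduled job whenever it becomes idle.\<close>

definition set_free :: "nat \<Rightarrow> real \<Rightarrow> (nat \<times> real) list \<Rightarrow> (nat \<times> real) list" where
  "set_free i t ps = map (\<lambda>(i', t'). (i', if i' = i then t else t')) ps"

fun forward :: "(job \<times> real) list \<Rightarrow> (nat \<times> real) list \<Rightarrow> segment list" where
  "forward [] ps = []"
| "forward ((j, p) # jps) ps =
     (let (i, t) = arg_min_list snd ps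
      in Seg (jid j) i t (t + p) (work j / p) # forward jps (set_free i (t + p) ps))"

fun backward :: "(job \<times> real) list \<Rightarrow> (nat \<times> real) list \<Rightarrow> segment list" where
  "backward [] ps = []"
| "backward ((j, p) # jps) ps =
     (let (i, t) = arg_min_list (\<lambda>q. - snd q) ps
      in Seg (jid j) i (t - p) t (work j / p) # backward jps (set_free i (t - p) ps))"

text \<open>With \<open>n\<close> jobs at most \<open>n\<close> processors are ever used, as \<open>arg_min_list\<close> prefers the first of
  several processors; hence it suffices to keep \<open>min m n\<close> of them in the state.\<close>

definition init_procs :: "nat \<Rightarrow> real \<Rightarrow> job list \<Rightarrow> (nat \<times> real) list" where
  "init_procs m t js = map (\<lambda>i. (i, t)) [0..<min m (length js)]"

definition crd ::
  "(nat \<Rightarrow> job list \<Rightarrow> segment list) \<Rightarrow> nat \<Rightarrow> real \<Rightarrow> job list \<Rightarrow> segment list" where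
  "crd opt m R js =
     forward (sort_key (\<lambda>q. deadline (fst q)) (proc_times opt m js)) (init_procs m R js)"

definition cd ::
  "(nat \<Rightarrow> job list \<Rightarrow> segment list) \<Rightarrow> nat \<Rightarrow> real \<Rightarrow> job list \<Rightarrow> segment list" where
  "cd opt m D js =
     backward (sort_key (\<lambda>q. - release (fst q)) (proc_times opt m js)) (init_procs m D js)"

definition with_deadline :: "real \<Rightarrow> job \<Rightarrow> job" where
  "with_deadline T j = Job (jid j) (work j) (release j) T"

definition with_release :: "real \<Rightarrow> job \<Rightarrow> job" where
  "with_release T j = Job (jid j) (work j) T (deadline j)"

definition cl ::
  "(nat \<Rightarrow> job list \<Rightarrow> segment list) \<Rightarrow> nat \<Rightarrow> job list \<Rightarrow> segment list" where
  "cl opt m js =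
     (let S = opt m js;
          T = min_list (map deadline js);
          L = filter (\<lambda>j. exec_before T S (jid j) \<ge> exec_after T S (jid j)) js;
          R = filter (\<lambda>j. exec_before T S (jid j) < exec_after T S (jid j)) js
      in cd opt m T (map (with_deadline T) L) @ crd opt m T (map (with_release T) R))"

text \<open>The list of all pairs \<open>(T\<^sub>\<ell>, J\<^sub>\<ell>)\<close>.  The recursion is on the jobs not yet assigned; after
  step \<open>\<ell>\<close> these are the jobs released after \<open>T\<^sub>\<ell>\<close>, so the condition \<open>T\<^sub>\<ell>\<^sub>-\<^sub>1 < r\<^sub>j\<close> is implicit.  In
  a valid instance every step assigns a job (one with deadline \<open>T\<^sub>\<ell>\<close>), so the test on the lengths
  always succeeds; it only makes the function total.\<close>

fun parts :: "job list \<Rightarrow> (real \<times> job list) list" where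
  "parts [] = []"
| "parts (j # js) =
     (let T = min_list (map deadline (j # js));
          part = filter (\<lambda>x. release x \<le> T) (j # js);
          rest = filter (\<lambda>x. T < release x) (j # js)
      in (T, part) # (if length rest < length (j # js) then parts rest else []))"

definition halve :: "real \<Rightarrow> job \<Rightarrow> job" where
  "halve T j = Job (jid j) (work j)
     (release j + (T - release j) / 2) (deadline j - (deadline j - T) / 2)"

definition agr ::
  "(nat \<Rightarrow> job list \<Rightarrow> segment list) \<Rightarrow> nat \<Rightarrow> job list \<Rightarrow> segment list" where
  "agr opt m js = concat (map (\<lambda>(T, jl). cl opt m (map (halve T) jl)) (parts js))"

section \<open>Running times\<close>

text \<open>Step-counting functions \<open>T_f\<close>, following the translation scheme of the imported theory of
  running-time functions: arithmetic operations and comparisons on numbers take constant time (in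
  particular those on real numbers), every call of a recursive function costs one step plus the time
  of the calls in its body.  \<open>T_opt m js\<close> is the time that the subroutine \<open>opt\<close> takes.\<close>

fun T_sum_list :: "'a list \<Rightarrow> nat" where
  "T_sum_list [] = 1"
| "T_sum_list (x # xs) = T_sum_list xs + 1"

fun T_min_list :: "'a list \<Rightarrow> nat" where
  "T_min_list [] = 1"
| "T_min_list (x # xs) = T_min_list xs + 1"

fun T_arg_min_list :: "'a list \<Rightarrow> nat" where
  "T_arg_min_list [] = 1"
| "T_arg_min_list (x # xs) = T_arg_min_list xs + 1"

definition T_upt :: "nat \<Rightarrow> nat \<Rightarrow> nat" where
  "T_upt i j = j - i + 1"

fun T_insort_key :: "('a \<Rightarrow> 'b::linorder) \<Rightarrow> 'a \<Rightarrow> 'a list \<Rightarrow> nat" where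
  "T_insort_key f x [] = 1"
| "T_insort_key f x (y # ys) = (if f x \<le> f y then 0 else T_insort_key f x ys) + 1"

fun T_sort_key :: "('a \<Rightarrow> 'b::linorder) \<Rightarrow> 'a list \<Rightarrow> nat" where
  "T_sort_key f [] = 1"
| "T_sort_key f (x # xs) = T_sort_key f xs + T_insort_key f x (sort_key f xs) + 1"

fun T_concat :: "'a list list \<Rightarrow> nat" where
  "T_concat [] = 1"
| "T_concat (xs # xss) = T_concat xss + T_append xs (concat xss) + 1"

text \<open>The common running time of \<open>exec_time\<close>, \<open>exec_before\<close> and \<open>exec_after\<close>, which traverse the list
  of pieces in the same way.\<close>

definition T_exec :: "segment list \<Rightarrow> nat" where
  "T_exec ss = T_map (\<lambda>_. 1) ss + T_sum_list ss"

definition T_proc_times ::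
  "(nat \<Rightarrow> job list \<Rightarrow> segment list) \<Rightarrow> (nat \<Rightarrow> job list \<Rightarrow> nat) \<Rightarrow> nat \<Rightarrow> job list \<Rightarrow> nat" where
  "T_proc_times opt T_opt m js = T_opt m js + T_map (\<lambda>_. T_exec (opt m js)) js"

definition T_set_free :: "(nat \<times> real) list \<Rightarrow> nat" where
  "T_set_free ps = T_map (\<lambda>_. 1) ps"

fun T_forward :: "(job \<times> real) list \<Rightarrow> (nat \<times> real) list \<Rightarrow> nat" where
  "T_forward [] ps = 1"
| "T_forward ((j, p) # jps) ps =
     (let (i, t) = arg_min_list snd ps
      in T_arg_min_list ps + T_set_free ps + T_forward jps (set_free i (t + p) ps) + 1)"

fun T_backward :: "(job \<times> real) list \<Rightarrow> (nat \<times> real) list \<Rightarrow> nat" where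
  "T_backward [] ps = 1"
| "T_backward ((j, p) # jps) ps =
     (let (i, t) = arg_min_list (\<lambda>q. - snd q) ps
      in T_arg_min_list ps + T_set_free ps + T_backward jps (set_free i (t - p) ps) + 1)"

definition T_init_procs :: "nat \<Rightarrow> job list \<Rightarrow> nat" where
  "T_init_procs m js =
     T_length js + T_upt 0 (min m (length js)) + T_map (\<lambda>_. 1) [0..<min m (length js)]"

definition T_crd ::
  "(nat \<Rightarrow> job list \<Rightarrow> segment list) \<Rightarrow> (nat \<Rightarrow> job list \<Rightarrow> nat) \<Rightarrow>
   nat \<Rightarrow> real \<Rightarrow> job list \<Rightarrow> nat" where
  "T_crd opt T_opt m R js =
     (let jps = proc_times opt m js; f = (\<lambda>q. deadline (fst q))
      in T_proc_times opt T_opt m js + T_sort_key f jps + T_init_procs m js +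
         T_forward (sort_key f jps) (init_procs m R js))"

definition T_cd ::
  "(nat \<Rightarrow> job list \<Rightarrow> segment list) \<Rightarrow> (nat \<Rightarrow> job list \<Rightarrow> nat) \<Rightarrow>
   nat \<Rightarrow> real \<Rightarrow> job list \<Rightarrow> nat" where
  "T_cd opt T_opt m D js =
     (let jps = proc_times opt m js; f = (\<lambda>q. - release (fst q))
      in T_proc_times opt T_opt m js + T_sort_key f jps + T_init_procs m js +
         T_backward (sort_key f jps) (init_procs m D js))"

definition T_cl ::
  "(nat \<Rightarrow> job list \<Rightarrow> segment list) \<Rightarrow> (nat \<Rightarrow> job list \<Rightarrow> nat) \<Rightarrow> nat \<Rightarrow> job list \<Rightarrow> nat" where
  "T_cl opt T_opt m js =
     (let S = opt m js;
          T = min_list (map deadline js);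
          L = filter (\<lambda>j. exec_before T S (jid j) \<ge> exec_after T S (jid j)) js;
          R = filter (\<lambda>j. exec_before T S (jid j) < exec_after T S (jid j)) js;
          L' = map (with_deadline T) L;
          R' = map (with_release T) R
      in T_opt m js + T_map (\<lambda>_. 1) js + T_min_list (map deadline js) +
         T_filter (\<lambda>_. 2 * T_exec S) js + T_filter (\<lambda>_. 2 * T_exec S) js +
         T_map (\<lambda>_. 1) L + T_map (\<lambda>_. 1) R +
         T_cd opt T_opt m T L' + T_crd opt T_opt m T R' +
         T_append (cd opt m T L') (crd opt m T R'))"

fun T_parts :: "job list \<Rightarrow> nat" where
  "T_parts [] = 1"
| "T_parts (j # js) =
     (let T = min_list (map deadline (j # js));
          rest = filter (\<lambda>x. T < release x) (j # js)
      in T_map (\<lambda>_. 1) (j # js) + T_min_list (map deadline (j # js)) +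
         T_filter (\<lambda>_. 1) (j # js) + T_filter (\<lambda>_. 1) (j # js) +
         T_length rest + T_length (j # js) +
         (if length rest < length (j # js) then T_parts rest else 0) + 1)"

definition T_agr ::
  "(nat \<Rightarrow> job list \<Rightarrow> segment list) \<Rightarrow> (nat \<Rightarrow> job list \<Rightarrow> nat) \<Rightarrow> nat \<Rightarrow> job list \<Rightarrow> nat" where
  "T_agr opt T_opt m js =
     T_parts js +
     T_map (\<lambda>(T, jl). T_map (\<lambda>_. 1) jl + T_cl opt T_opt m (map (halve T) jl)) (parts js) +
     T_concat (map (\<lambda>(T, jl). cl opt m (map (halve T) jl)) (parts js))"

section \<open>Approximation algorithms\<close>

text \<open>The number of processors is encoded in binary; each job counts one unit, as real numbers are
  unit-size data.\<close>

definition input_size :: "nat \<Rightarrow> job list \<Rightarrow> nat" where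
  "input_size m js = length js + floorlog 2 m"

text \<open>Polynomial running time on the instances satisfying \<open>P\<close>, uniformly in the number \<open>m\<close> of
  processors.  Writing down the output is part of the computation.\<close>

definition polynomial_time ::
  "(job list \<Rightarrow> bool) \<Rightarrow> (nat \<Rightarrow> job list \<Rightarrow> segment list) \<Rightarrow> (nat \<Rightarrow> job list \<Rightarrow> nat) \<Rightarrow> bool" where
  "polynomial_time P A T_A \<longleftrightarrow>
     (\<exists>p :: nat poly. \<forall>m\<ge>1. \<forall>js. valid_instance js \<and> P js \<longrightarrow>
        length (A m js) \<le> T_A m js \<and> T_A m js \<le> poly p (input_size m js))"

definition approximation_algorithm ::
  "real \<Rightarrow> (job list \<Rightarrow> bool) \<Rightarrow> (nat \<Rightarrow> real) \<Rightarrow>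
   (nat \<Rightarrow> job list \<Rightarrow> segment list) \<Rightarrow> (nat \<Rightarrow> job list \<Rightarrow> nat) \<Rightarrow> bool" where
  "approximation_algorithm \<alpha> P \<rho> A T_A \<longleftrightarrow>
     polynomial_time P A T_A \<and>
     (\<forall>m\<ge>1. \<forall>js. valid_instance js \<and> P js \<longrightarrow>
        wf_segments m (A m js) \<and>
        nonpreemptive_feasible m js (schedule_of (A m js)) \<and>
        energy \<alpha> m (schedule_of (A m js)) \<le> ennreal (\<rho> m) * nonpreemptive_opt \<alpha> m js)"

end

theory Submission
  imports Defs
begin

text \<open>
  By convexity of the power function, a schedule that executes job \<open>j\<close> for total time \<open>e\<^sub>j\<close> uses at least
  the energy \<open>\<Sum>\<^sub>j (w\<^sub>j / e\<^sub>j)\<^sup>\<alpha> e\<^sub>j\<close>, and dividing all \<open>e\<^sub>j\<close> by \<open>c\<close> multiplies this sum by \<open>c\<^bsup>\<alpha> - 1\<^esup>\<close>.  Three such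
  losses are multiplied.

  \<^item> Common release date or deadline, factor \<open>2 - 1/m\<close>: jobs before \<open>j\<close> in the EDF order fit, together
    with \<open>j\<close>, into the window of \<open>j\<close> on \<open>m\<close> processors, so Graham's bound for list scheduling with the
    shortened times gives a completion time within the window.

  \<^item> Cliques, factor \<open>2\<close>: a job of \<open>L\<close> is executed for at least \<open>e\<^sub>j / 2\<close> before \<open>T\<close>, so restricting the
    preemptive schedule to that time gives a preemptive schedule of the instance with deadline \<open>T\<close>;
    likewise for \<open>R\<close>.

  \<^item> Agreeable instances, factor \<open>2\<close>: contracting any feasible schedule of the jobs of \<open>J\<^sub>\<ell>\<close> towards \<open>T\<^sub>\<ell>\<close> by
    the factor \<open>2\<close> makes it feasible for the halved windows.  Agreeability makes the halved windows of
    different \<open>J\<^sub>\<ell>\<close> disjoint: if \<open>j \<in> J\<^sub>\<ell>\<close> and \<open>j' \<in> J\<^sub>\<ell>'\<close> with \<open>\<ell> < \<ell>'\<close>, then \<open>T\<^sub>\<ell> < r\<^sub>j'\<close> and \<open>d\<^sub>j \<le> T\<^sub>\<ell>'\<close>.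
\<close>

section \<open>Schedules given by segments\<close>

lemma wf_segments_Nil [simp]: "wf_segments m []"
  by (simp add: wf_segments_def)

lemma wf_segments_Cons:
  "wf_segments m (s # ss) \<longleftrightarrow> seg_proc s < m \<and> seg_start s < seg_end s \<and> wf_segments m ss \<and>
     (\<forall>s'\<in>set ss. seg_proc s = seg_proc s' \<longrightarrow> seg_end s \<le> seg_start s' \<or> seg_end s' \<le> seg_start s)"
  by (auto simp: wf_segments_def)

lemma wf_segments_append:
  "wf_segments m (ss @ ss') \<longleftrightarrow> wf_segments m ss \<and> wf_segments m ss' \<and>
     (\<forall>s\<in>set ss. \<forall>s'\<in>set ss'. seg_proc s = seg_proc s' \<longrightarrow>
        seg_end s \<le> seg_start s' \<or> seg_end s' \<le> seg_start s)"
  by (auto simp: wf_segments_def sorted_wrt_append)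

lemma wf_segmentsD:
  assumes "wf_segments m ss" "s \<in> set ss"
  shows "seg_proc s < m" "seg_start s < seg_end s"
  using assms by (auto simp: wf_segments_def)

abbreviation running :: "segment \<Rightarrow> nat \<Rightarrow> real \<Rightarrow> bool" where
  "running s i t \<equiv> seg_proc s = i \<and> seg_start s \<le> t \<and> t < seg_end s"

text \<open>\<open>find\<close> returns the first match, but pieces on one processor do not overlap,
  so the match is unique and the order of the list is irrelevant.\<close>

lemma active_Some_iff:
  assumes "wf_segments m ss"
  shows "active ss i t = Some s \<longleftrightarrow> s \<in> set ss \<and> running s i t"
  using assms
proof (induction ss)
  case (Cons x ss)
  then show ?case
    unfolding active_def wf_segments_Cons by (force split: if_splits)
qed (simp add: active_def)

text \<open>At most one summand is nonzero. As a sum, the lookup becomes a finite combination of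
  interval indicators, to which linearity of the integral applies.\<close>

lemma active_eq_sum_list:
  fixes h :: "segment \<Rightarrow> 'a :: comm_monoid_add"
  assumes "wf_segments m ss"
  shows "(case active ss i t of None \<Rightarrow> 0 | Some s \<Rightarrow> h s) =
         (\<Sum>s\<leftarrow>ss. if running s i t then h s else 0)"
  using assms
proof (induction ss)
  case (Cons x ss)
  show ?case
  proof (cases "running x i t")
    case True
    have "\<not> running s i t" if "s \<in> set ss" for s
      using Cons.prems True that unfolding wf_segments_Cons by force
    hence "(\<Sum>s\<leftarrow>ss. if running s i t then h s else 0) = (\<Sum>s\<leftarrow>ss. 0)"
      by (intro arg_cong[of _ _ sum_list] map_cong) auto
    thus ?thesis using True by (simp add: active_def)
  next
    case False
    thus ?thesis using Cons by (auto simp: active_def wf_segments_Cons)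
  qed
qed (simp add: active_def)

section \<open>Measurability and integrals of piecewise constant functions\<close>

lemma borel_measurable_sum_list:
  fixes f :: "_ \<Rightarrow> _ \<Rightarrow> 'a :: {second_countable_topology, topological_comm_monoid_add}"
  assumes "\<And>x. x \<in> set xs \<Longrightarrow> f x \<in> borel_measurable M"
  shows "(\<lambda>t. \<Sum>x\<leftarrow>xs. f x t) \<in> borel_measurable M"
  using assms by (induction xs) auto

lemma nn_integral_sum_list:
  fixes f :: "_ \<Rightarrow> _ \<Rightarrow> ennreal"
  assumes "\<And>x. x \<in> set xs \<Longrightarrow> f x \<in> borel_measurable M"
  shows "(\<integral>\<^sup>+t. (\<Sum>x\<leftarrow>xs. f x t) \<partial>M) = (\<Sum>x\<leftarrow>xs. \<integral>\<^sup>+t. f x t \<partial>M)"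
  using assms
proof (induction xs)
  case (Cons x xs)
  have "(\<lambda>t. \<Sum>x\<leftarrow>xs. f x t) \<in> borel_measurable M"
    using Cons.prems by (intro borel_measurable_sum_list) auto
  with Cons show ?case by (simp add: nn_integral_add)
qed simp

lemma sum_list_ennreal:
  "(\<And>x. x \<in> set xs \<Longrightarrow> 0 \<le> f x) \<Longrightarrow> (\<Sum>x\<leftarrow>xs. ennreal (f x)) = ennreal (\<Sum>x\<leftarrow>xs. f x)"
proof (induction xs)
  case (Cons a xs)
  have "0 \<le> f a" "0 \<le> (\<Sum>x\<leftarrow>xs. f x)"
    using Cons.prems by (auto intro!: sum_list_nonneg)
  with Cons show ?case by simp
qed simp

lemma sum_sum_list_swap:
  "(\<Sum>i\<in>A. \<Sum>x\<leftarrow>xs. f i x) = (\<Sum>x\<leftarrow>xs. \<Sum>i\<in>A. f i x)"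
  for f :: "_ \<Rightarrow> _ \<Rightarrow> 'a :: comm_monoid_add"
  by (induction xs) (auto simp: sum.distrib)

lemma measurable_active:
  fixes h :: "segment \<Rightarrow> 'a :: {second_countable_topology, topological_comm_monoid_add}"
  assumes "wf_segments m ss"
  shows "(\<lambda>t. case active ss i t of None \<Rightarrow> 0 | Some s \<Rightarrow> h s) \<in> borel_measurable borel"
proof -
  have "(\<lambda>t. \<Sum>s\<leftarrow>ss. if running s i t then h s else 0) \<in> borel_measurable borel"
    by (induction ss) auto
  thus ?thesis by (simp add: active_eq_sum_list[OF assms])
qed

text \<open>The weight \<open>h\<close> is kept general: powers of the speed yield energy, the speed
  restricted to one job yields work, and the indicator of a set of jobs yields execution
  time.\<close>

lemma integral_active:
  assumes "wf_segments m ss" "\<And>s. s \<in> set ss \<Longrightarrow> 0 \<le> h s"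
  shows "(\<Sum>i<m. \<integral>\<^sup>+t. (case active ss i t of None \<Rightarrow> 0 | Some s \<Rightarrow> ennreal (h s)) \<partial>lborel) =
         ennreal (\<Sum>s\<leftarrow>ss. h s * (seg_end s - seg_start s))"
proof -
  have 1: "(\<integral>\<^sup>+t. (if running s i t then ennreal (h s) else 0) \<partial>lborel) =
        (if seg_proc s = i then ennreal (h s * (seg_end s - seg_start s)) else 0)"
    if "s \<in> set ss" for s i
  proof -
    have "(\<integral>\<^sup>+t. (if running s i t then ennreal (h s) else 0) \<partial>lborel) =
          (\<integral>\<^sup>+t. (if seg_proc s = i then ennreal (h s) else 0) * indicator {seg_start s..<seg_end s} t \<partial>lborel)"
      by (intro nn_integral_cong) (auto simp: indicator_def)
    also have "\<dots> = (if seg_proc s = i then ennreal (h s) else 0) * ennreal (seg_end s - seg_start s)"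
      using wf_segmentsD[OF assms(1) that] by (subst nn_integral_cmult_indicator) auto
    finally show ?thesis
      using wf_segmentsD[OF assms(1) that] assms(2)[OF that] by (simp add: ennreal_mult)
  qed
  have "(\<Sum>i<m. \<integral>\<^sup>+t. (case active ss i t of None \<Rightarrow> 0 | Some s \<Rightarrow> ennreal (h s)) \<partial>lborel) =
        (\<Sum>i<m. \<Sum>s\<leftarrow>ss. \<integral>\<^sup>+t. (if running s i t then ennreal (h s) else 0) \<partial>lborel)"
    unfolding active_eq_sum_list[OF assms(1)]
    by (intro sum.cong refl nn_integral_sum_list) auto
  also have "\<dots> = (\<Sum>s\<leftarrow>ss. \<Sum>i<m. \<integral>\<^sup>+t. (if running s i t then ennreal (h s) else 0) \<partial>lborel)"
    by (rule sum_sum_list_swap)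
  also have "\<dots> = (\<Sum>s\<leftarrow>ss. ennreal (h s * (seg_end s - seg_start s)))"
    using wf_segmentsD[OF assms(1)]
    by (intro arg_cong[of _ _ sum_list] map_cong refl) (simp add: 1)
  also have "\<dots> = ennreal (\<Sum>s\<leftarrow>ss. h s * (seg_end s - seg_start s))"
    using wf_segmentsD[OF assms(1)] assms(2) by (intro sum_list_ennreal) (simp add: less_imp_le)
  finally show ?thesis .
qed

section \<open>Energy, work and feasibility read off from the segments\<close>

definition seg_energy :: "real \<Rightarrow> segment list \<Rightarrow> real" where
  "seg_energy \<alpha> ss = (\<Sum>s\<leftarrow>ss. seg_speed s powr \<alpha> * (seg_end s - seg_start s))"

definition seg_work :: "segment list \<Rightarrow> nat \<Rightarrow> real" where
  "seg_work ss k = (\<Sum>s\<leftarrow>ss. (if seg_job s = k then seg_speed s else 0) * (seg_end s - seg_start s))"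

lemma energy_schedule_of:
  assumes "wf_segments m ss"
  shows "energy \<alpha> m (schedule_of ss) = ennreal (seg_energy \<alpha> ss)"
proof -
  \<comment> \<open>Idle time contributes nothing because \<open>0 powr \<alpha> = 0\<close> for
    every exponent.\<close>
  have *: "ennreal ((case active ss i t of None \<Rightarrow> 0 | Some s \<Rightarrow> seg_speed s) powr \<alpha>) =
     (case active ss i t of None \<Rightarrow> 0 | Some s \<Rightarrow> ennreal (seg_speed s powr \<alpha>))" for i t
    by (auto split: option.splits)
  show ?thesis
    unfolding energy_def schedule_of_def seg_energy_def schedule.simps *
    by (rule integral_active[OF assms]) auto
qed

lemma work_done_schedule_of:
  assumes "wf_segments m ss" "\<And>s. s \<in> set ss \<Longrightarrow> 0 \<le> seg_speed s"
  shows "work_done m (schedule_of ss) k = ennreal (seg_work ss k)"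
proof -
  have *: "ennreal (case active ss i t of None \<Rightarrow> 0 | Some s \<Rightarrow> seg_speed s) *
        indicator {t. map_option seg_job (active ss i t) = Some k} t =
     (case active ss i t of None \<Rightarrow> 0 | Some s \<Rightarrow> ennreal (if seg_job s = k then seg_speed s else 0))" for i t
    by (auto split: option.splits simp: indicator_def)
  show ?thesis
    unfolding work_done_def schedule_of_def seg_work_def schedule.simps *
    by (rule integral_active[OF assms(1)]) (use assms(2) in auto)
qed

lemma preemptive_feasible_schedule_ofI:
  assumes wf: "wf_segments m ss"
    and window: "\<And>s. s \<in> set ss \<Longrightarrow>
      \<exists>j\<in>set js. jid j = seg_job s \<and> release j \<le> seg_start s \<and> seg_end s \<le> deadline j"
    and nonneg: "\<And>s. s \<in> set ss \<Longrightarrow> 0 \<le> seg_speed s"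
    and disj: "\<And>s s' t. s \<in> set ss \<Longrightarrow> s' \<in> set ss \<Longrightarrow> seg_job s = seg_job s' \<Longrightarrow>
      running s (seg_proc s) t \<Longrightarrow> running s' (seg_proc s') t \<Longrightarrow> seg_proc s = seg_proc s'"
    and works: "\<And>j. j \<in> set js \<Longrightarrow> seg_work ss (jid j) = work j"
  shows "preemptive_feasible m js (schedule_of ss)"
  unfolding preemptive_feasible_def
proof (intro conjI ballI allI impI)
  fix i assume "i < m"
  show "speed (schedule_of ss) i \<in> borel_measurable borel"
    using measurable_active[OF wf, of seg_speed i] by (simp add: schedule_of_def)
  fix k
  \<comment> \<open>The set of times at which \<open>k\<close> runs is the preimage of 1 under its
    piecewise constant indicator.\<close>
  have "(\<lambda>t. case active ss i t of None \<Rightarrow> 0 | Some s \<Rightarrow> if seg_job s = k then 1 else (0::real)) \<in> borel_measurable borel"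
    by (rule measurable_active[OF wf])
  hence "(\<lambda>t. case active ss i t of None \<Rightarrow> 0 | Some s \<Rightarrow> if seg_job s = k then 1 else (0::real)) -` {1} \<inter> space borel \<in> sets borel"
    by (rule measurable_sets) auto
  also have "(\<lambda>t. case active ss i t of None \<Rightarrow> 0 | Some s \<Rightarrow> if seg_job s = k then 1 else (0::real)) -` {1} \<inter> space borel
     = {t. run (schedule_of ss) i t = Some k}"
    by (auto simp: schedule_of_def split: option.splits if_splits)
  finally show "{t. run (schedule_of ss) i t = Some k} \<in> sets borel" .
next
  fix i t
  show "0 \<le> speed (schedule_of ss) i t"
    using nonneg by (auto simp: schedule_of_def active_Some_iff[OF wf] split: option.splits)
  show "run (schedule_of ss) i t = None \<Longrightarrow> speed (schedule_of ss) i t = 0"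
    by (auto simp: schedule_of_def)
next
  fix i t k assume "run (schedule_of ss) i t = Some k"
  then obtain s where "s \<in> set ss" "running s i t" "seg_job s = k"
    by (auto simp: schedule_of_def active_Some_iff[OF wf])
  with window[of s] show "\<exists>j\<in>set js. jid j = k \<and> release j \<le> t \<and> t \<le> deadline j"
    by fastforce
next
  fix i i' t k
  assume "run (schedule_of ss) i t = Some k \<and> run (schedule_of ss) i' t = Some k"
  then obtain s s' where "s \<in> set ss" "s' \<in> set ss" "running s i t" "running s' i' t" "seg_job s = seg_job s'"
    by (auto simp: schedule_of_def active_Some_iff[OF wf])
  thus "i = i'" using disj[of s s' t] by simp
next
  fix j assume "j \<in> set js"
  thus "work_done m (schedule_of ss) (jid j) = ennreal (work j)"
    using works by (simp add: work_done_schedule_of[OF wf nonneg])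
qed

lemma preemptive_feasible_schedule_ofD:
  assumes wf: "wf_segments m ss" and feas: "preemptive_feasible m js (schedule_of ss)"
  shows "\<And>s j. distinct (map jid js) \<Longrightarrow> s \<in> set ss \<Longrightarrow> j \<in> set js \<Longrightarrow> jid j = seg_job s \<Longrightarrow>
       release j \<le> seg_start s \<and> seg_end s \<le> deadline j"
    and "\<And>s. s \<in> set ss \<Longrightarrow> 0 \<le> seg_speed s"
    and "\<And>s s' t. s \<in> set ss \<Longrightarrow> s' \<in> set ss \<Longrightarrow> seg_job s = seg_job s' \<Longrightarrow>
      running s (seg_proc s) t \<Longrightarrow> running s' (seg_proc s') t \<Longrightarrow> seg_proc s = seg_proc s'"
    and "\<And>j. j \<in> set js \<Longrightarrow> 0 \<le> work j \<Longrightarrow> seg_work ss (jid j) = work j"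
proof -
  have run: "run (schedule_of ss) (seg_proc s) t = Some (seg_job s)"
    "speed (schedule_of ss) (seg_proc s) t = seg_speed s"
    if "s \<in> set ss" "seg_start s \<le> t" "t < seg_end s" for s t
  proof -
    have "active ss (seg_proc s) t = Some s"
      using that by (simp add: active_Some_iff[OF wf])
    thus "run (schedule_of ss) (seg_proc s) t = Some (seg_job s)"
      "speed (schedule_of ss) (seg_proc s) t = seg_speed s"
      by (auto simp: schedule_of_def)
  qed
  note wfD = wf_segmentsD[OF wf]
  have win: "\<exists>j\<in>set js. jid j = seg_job s \<and> release j \<le> t \<and> t \<le> deadline j"
    if "s \<in> set ss" "seg_start s \<le> t" "t < seg_end s" for s t
    using feas run(1)[OF that] wfD(1)[OF that(1)] unfolding preemptive_feasible_def by blast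
  show "release j \<le> seg_start s \<and> seg_end s \<le> deadline j"
    if "distinct (map jid js)" "s \<in> set ss" "j \<in> set js" "jid j = seg_job s" for s j
  proof -
    have *: "release j \<le> t \<and> t \<le> deadline j" if "seg_start s \<le> t" "t < seg_end s" for t
      using win[OF \<open>s \<in> set ss\<close> that] \<open>distinct _\<close> \<open>j \<in> _\<close> \<open>jid j = _\<close>
      by (metis distinct_map inj_onD)
    \<comment> \<open>Segments are half-open, so the end is not itself a running time; the bound is
      obtained as a limit from the left.\<close>
    have "seg_end s \<le> deadline j"
    proof (rule dense_le_bounded[OF wfD(2)[OF \<open>s \<in> set ss\<close>]])
      fix t assume "seg_start s < t" "t < seg_end s"
      thus "t \<le> deadline j" using *[of t] by simp
    qed
    thus ?thesis using *[of "seg_start s"] wfD(2)[OF \<open>s \<in> set ss\<close>] by simp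
  qed
  show nonneg: "0 \<le> seg_speed s" if "s \<in> set ss" for s
  proof -
    have "0 \<le> speed (schedule_of ss) (seg_proc s) (seg_start s)"
      using feas wfD(1)[OF that] unfolding preemptive_feasible_def by blast
    thus ?thesis using run(2)[OF that, of "seg_start s"] wfD(2)[OF that] by simp
  qed
  show "seg_proc s = seg_proc s'"
    if "s \<in> set ss" "s' \<in> set ss" "seg_job s = seg_job s'"
      "running s (seg_proc s) t" "running s' (seg_proc s') t" for s s' t
  proof -
    have "\<forall>i<m. \<forall>i'<m. \<forall>t k. run (schedule_of ss) i t = Some k \<and> run (schedule_of ss) i' t = Some k \<longrightarrow> i = i'"
      using feas unfolding preemptive_feasible_def by (elim conjE)
    thus ?thesis using run(1)[of s t] run(1)[of s' t] that wfD(1)[of s] wfD(1)[of s'] by auto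
  qed
  show "seg_work ss (jid j) = work j" if "j \<in> set js" "0 \<le> work j" for j
  proof -
    have "ennreal (seg_work ss (jid j)) = ennreal (work j)"
      using feas that(1) work_done_schedule_of[OF wf nonneg, of "jid j"]
      unfolding preemptive_feasible_def by simp
    \<comment> \<open>\<open>ennreal\<close> sends all negative reals to 0, so the equation descends
      to real numbers only after both sides are known to be nonnegative.\<close>
    moreover have "0 \<le> seg_work ss (jid j)"
      unfolding seg_work_def using nonneg wfD(2) by (intro sum_list_nonneg) (auto simp: less_imp_le)
    ultimately show ?thesis using that by simp
  qed
qed

section \<open>List scheduling\<close>

lemma arg_min_list_obtain:
  assumes "ps \<noteq> []"
  obtains i t where "arg_min_list f ps = (i, t)" "(i, t) \<in> set ps" "\<And>q. q \<in> set ps \<Longrightarrow> f (i, t) \<le> f q"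
proof -
  obtain i t where it: "arg_min_list f ps = (i, t)" by fastforce
  moreover have "(i, t) \<in> set ps" using arg_min_list_in[OF assms, of f] it by simp
  moreover have "f (i, t) \<le> f q" if "q \<in> set ps" for q
    using f_arg_min_list_f[OF assms, of f] it that by (simp add: Min_le)
  ultimately show ?thesis using that by blast
qed

section \<open>Bookkeeping of the times at which processors become free\<close>

lemma map_fst_set_free [simp]: "map fst (set_free i t ps) = map fst ps"
  by (auto simp: set_free_def)

lemma length_set_free [simp]: "length (set_free i t ps) = length ps"
  by (auto simp: set_free_def)

lemma set_free_eq_Nil_iff [simp]: "set_free i t ps = [] \<longleftrightarrow> ps = []"
  by (auto simp: set_free_def)

lemma set_free_idem: "i \<notin> fst ` set ps \<Longrightarrow> set_free i t ps = ps"
  by (induction ps) (auto simp: set_free_def)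

lemma sum_list_set_free:
  assumes "distinct (map fst ps)" "(i, t) \<in> set ps"
  shows "(\<Sum>q\<leftarrow>set_free i t' ps. snd q) = (\<Sum>q\<leftarrow>ps. snd q) + (t' - t)"
  using assms
proof (induction ps)
  case (Cons q ps)
  show ?case
  proof (cases "fst q = i")
    case True
    with Cons.prems have "i \<notin> fst ` set ps" by auto
    moreover from this Cons.prems have "q = (i, t)" by force
    ultimately show ?thesis
      using set_free_idem[of i ps t'] by (simp add: set_free_def)
  next
    case False
    with Cons show ?thesis by (auto simp: set_free_def split: prod.splits)
  qed
qed simp

text \<open>Placing one job makes at most one processor busy beyond \<open>R\<close>. The number of
  unscheduled jobs drops by one as well, so having a free processor for each job is an invariant of
  list scheduling.\<close>

lemma length_filter_set_free:
  assumes "distinct (map fst ps)"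
  shows "length (filter (\<lambda>q. snd q \<le> R) ps) \<le> length (filter (\<lambda>q. snd q \<le> R) (set_free i t ps)) + 1"
  using assms
proof (induction ps)
  case (Cons q ps)
  show ?case
  proof (cases "fst q = i")
    case True
    with Cons.prems have "i \<notin> fst ` set ps" by auto
    thus ?thesis using set_free_idem[of i ps t] by (simp add: set_free_def)
  next
    case False
    with Cons show ?thesis by (auto simp: set_free_def split: prod.splits)
  qed
qed simp

text \<open>Processing times are positive, so every update only moves a free time later. This is
  what keeps later segments on a processor disjoint from earlier ones.\<close>

lemma forward_starts_after_free:
  assumes "ps \<noteq> []" "distinct (map fst ps)" "\<forall>q\<in>set jps. 0 < snd q" "s \<in> set (forward jps ps)"
  shows "\<exists>t. (seg_proc s, t) \<in> set ps \<and> t \<le> seg_start s"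
  using assms
proof (induction jps ps rule: forward.induct)
  case (2 j p jps ps)
  obtain i t where it: "arg_min_list snd ps = (i, t)" "(i, t) \<in> set ps"
    using arg_min_list_obtain[OF "2.prems"(1)] by metis
  show ?case
  proof (cases "s = Seg (jid j) i t (t + p) (work j / p)")
    case False
    hence "s \<in> set (forward jps (set_free i (t + p) ps))"
      using "2.prems"(4) it by simp
    hence "\<exists>u. (seg_proc s, u) \<in> set (set_free i (t + p) ps) \<and> u \<le> seg_start s"
      using "2.prems" it by (intro "2.IH"[OF it(1)[symmetric] refl]) auto
    then obtain u u' where u: "u \<le> seg_start s" "(seg_proc s, u') \<in> set ps"
        "u = (if seg_proc s = i then t + p else u')"
      by (auto simp: set_free_def)
    have "0 < p" using "2.prems"(3) by simp
    show ?thesis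
    proof (cases "seg_proc s = i")
      case True
      thus ?thesis using u it \<open>0 < p\<close> by (intro exI[of _ t]) auto
    next
      case False
      thus ?thesis using u by auto
    qed
  qed (use it in auto)
qed simp

lemma wf_segments_forward:
  assumes "ps \<noteq> []" "distinct (map fst ps)" "\<forall>q\<in>set jps. 0 < snd q" "\<forall>q\<in>set ps. fst q < m"
  shows "wf_segments m (forward jps ps)"
  using assms
proof (induction jps ps rule: forward.induct)
  case (2 j p jps ps)
  obtain i t where it: "arg_min_list snd ps = (i, t)" "(i, t) \<in> set ps"
    using arg_min_list_obtain[OF "2.prems"(1)] by metis
  have "0 < p" using "2.prems"(3) by simp
  have "wf_segments m (forward jps (set_free i (t + p) ps))"
  proof (intro "2.IH"[OF it(1)[symmetric] refl])
    show "\<forall>q\<in>set (set_free i (t + p) ps). fst q < m"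
      using "2.prems"(4) by (auto simp: set_free_def)
  qed (use "2.prems" in auto)
  \<comment> \<open>After the update every entry for processor \<open>i\<close> equals
    \<open>t + p\<close>, so no later piece on \<open>i\<close> can begin before the new piece
    ends.\<close>
  moreover have "t + p \<le> seg_start s"
    if s: "s \<in> set (forward jps (set_free i (t + p) ps))" "i = seg_proc s" for s
  proof -
    obtain u where "(seg_proc s, u) \<in> set (set_free i (t + p) ps)" "u \<le> seg_start s"
      using forward_starts_after_free[OF _ _ _ s(1)] "2.prems" by auto
    thus ?thesis using s(2) by (auto simp: set_free_def)
  qed
  ultimately show ?case using it "2.prems"(4) \<open>0 < p\<close> by (auto simp: wf_segments_Cons)
qed simp

text \<open>Graham's argument: a job starts when the least loaded processor becomes idle, hence not later
  than the average load.  With an idle processor for each job, all of them start at once.\<close>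

lemma forward_bounds:
  assumes "ps \<noteq> []" "distinct (map fst ps)" "s \<in> set (forward jps ps)"
  shows "\<exists>xs j p ys. jps = xs @ (j, p) # ys \<and> seg_job s = jid j \<and> seg_end s = seg_start s + p \<and>
           seg_speed s = work j / p \<and>
           real (length ps) * seg_start s \<le> (\<Sum>q\<leftarrow>ps. snd q) + (\<Sum>q\<leftarrow>xs. snd q) \<and>
           (length jps \<le> length (filter (\<lambda>q. snd q \<le> R) ps) \<longrightarrow> seg_start s \<le> R)"
  using assms
proof (induction jps ps rule: forward.induct)
  case (2 j p jps ps)
  obtain i t where it: "arg_min_list snd ps = (i, t)" "(i, t) \<in> set ps" "\<And>q. q \<in> set ps \<Longrightarrow> t \<le> snd q"
    using arg_min_list_obtain[OF "2.prems"(1), of snd] by auto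
  show ?case
  proof (cases "s = Seg (jid j) i t (t + p) (work j / p)")
    case True
    have "(\<Sum>q\<leftarrow>ps. t) \<le> (\<Sum>q\<leftarrow>ps. snd q)"
      using it(3) by (intro sum_list_mono) auto
    hence "real (length ps) * t \<le> (\<Sum>q\<leftarrow>ps. snd q)"
      by (simp add: sum_list_triv)
    moreover have "t \<le> R" if len: "length ((j, p) # jps) \<le> length (filter (\<lambda>q. snd q \<le> R) ps)"
    proof -
      have "filter (\<lambda>q. snd q \<le> R) ps \<noteq> []" using len by force
      then obtain q where "q \<in> set ps" "snd q \<le> R" by (auto simp: filter_empty_conv)
      thus ?thesis using it(3)[of q] by simp
    qed
    ultimately show ?thesis using True by (intro exI[of _ "[]"]) auto
  next
    case False
    hence "s \<in> set (forward jps (set_free i (t + p) ps))"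
      using "2.prems"(3) it by simp
    hence "\<exists>xs j' p' ys. jps = xs @ (j', p') # ys \<and> seg_job s = jid j' \<and> seg_end s = seg_start s + p' \<and>
           seg_speed s = work j' / p' \<and>
           real (length (set_free i (t + p) ps)) * seg_start s \<le>
             (\<Sum>q\<leftarrow>set_free i (t + p) ps. snd q) + (\<Sum>q\<leftarrow>xs. snd q) \<and>
           (length jps \<le> length (filter (\<lambda>q. snd q \<le> R) (set_free i (t + p) ps)) \<longrightarrow> seg_start s \<le> R)"
      using "2.prems" by (intro "2.IH"[OF it(1)[symmetric] refl]) auto
    then obtain xs j' p' ys where *: "jps = xs @ (j', p') # ys" "seg_job s = jid j'"
        "seg_end s = seg_start s + p'" "seg_speed s = work j' / p'"
        "real (length (set_free i (t + p) ps)) * seg_start s \<le>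
             (\<Sum>q\<leftarrow>set_free i (t + p) ps. snd q) + (\<Sum>q\<leftarrow>xs. snd q)"
        "length jps \<le> length (filter (\<lambda>q. snd q \<le> R) (set_free i (t + p) ps)) \<longrightarrow> seg_start s \<le> R"
      by blast
    show ?thesis
    proof (intro exI conjI)
      show "(j, p) # jps = ((j, p) # xs) @ (j', p') # ys" using * by simp
      \<comment> \<open>Placing the first job adds exactly \<open>p\<close> to the total of the free
        times, and \<open>p\<close> is also the summand by which the prefix grows, so the bound from
        the induction hypothesis is already the required one.\<close>
      show "real (length ps) * seg_start s \<le> (\<Sum>q\<leftarrow>ps. snd q) + (\<Sum>q\<leftarrow>(j, p) # xs. snd q)"
        using *(5) sum_list_set_free[OF "2.prems"(2) it(2), of "t + p"] by simp
      show "length ((j, p) # jps) \<le> length (filter (\<lambda>q. snd q \<le> R) ps) \<longrightarrow> seg_start s \<le> R"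
        using *(6) length_filter_set_free[OF "2.prems"(2), of R i "t + p"] by auto
    qed (use * in auto)
  qed
qed simp

section \<open>Time reversal\<close>

definition seg_mirror :: "segment \<Rightarrow> segment" where
  "seg_mirror s = Seg (seg_job s) (seg_proc s) (- seg_end s) (- seg_start s) (seg_speed s)"

lemma seg_mirror_simps [simp]:
  "seg_job (seg_mirror s) = seg_job s" "seg_proc (seg_mirror s) = seg_proc s"
  "seg_start (seg_mirror s) = - seg_end s" "seg_end (seg_mirror s) = - seg_start s"
  "seg_speed (seg_mirror s) = seg_speed s"
  by (auto simp: seg_mirror_def)

lemma arg_min_list_map:
  "ps \<noteq> [] \<Longrightarrow> arg_min_list f (map g ps) = g (arg_min_list (\<lambda>x. f (g x)) ps)"
  by (induction "\<lambda>x. f (g x)" ps rule: arg_min_list.induct) (auto simp: Let_def)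

text \<open>Under the substitution of \<open>- t\<close> for \<open>t\<close>, the latest free time
  becomes the earliest one. The compared keys are the same numbers on both sides, hence ties are
  broken alike. Everything about \<open>backward\<close> then follows from the results on
  \<open>forward\<close>.\<close>

lemma backward_eq_mirror_forward:
  "ps \<noteq> [] \<Longrightarrow> backward jps ps = map seg_mirror (forward jps (map (apsnd uminus) ps))"
proof (induction jps ps rule: backward.induct)
  case (2 j p jps ps)
  obtain i t where it: "arg_min_list (\<lambda>q. - snd q) ps = (i, t)" by fastforce
  have it': "arg_min_list snd (map (apsnd uminus) ps) = (i, - t)"
    using it "2.prems" by (simp add: arg_min_list_map)
  have "map (apsnd uminus) (set_free i (t - p) ps) =
        set_free i (- t + p) (map (apsnd uminus) ps)"
    by (auto simp: set_free_def)
  moreover have "backward jps (set_free i (t - p) ps) =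
    map seg_mirror (forward jps (map (apsnd uminus) (set_free i (t - p) ps)))"
    using "2.prems" by (intro "2.IH"[OF it[symmetric] refl]) simp
  ultimately show ?case using it it' by (simp add: seg_mirror_def[of "Seg _ _ _ _ _"])
qed simp

section \<open>Execution times and energy\<close>

lemma sum_list_cong_mset:
  "mset xs = mset ys \<Longrightarrow> (\<Sum>x\<leftarrow>xs. f x) = (\<Sum>x\<leftarrow>ys. f x)"
  for f :: "_ \<Rightarrow> 'a :: comm_monoid_add"
  by (metis mset_map sum_mset_sum_list)

text \<open>Double counting: the total length of the pieces is the integral over time of the number
  of processors busy with jobs of \<open>K\<close>. The integrand is at most \<open>c\<close> and
  vanishes outside \<open>[a, b]\<close>. It is used with \<open>c = 1\<close> for a single job,
  which never runs in parallel with itself, and with \<open>c = m\<close> for a set of jobs.\<close>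

lemma total_length_le:
  assumes wf: "wf_segments m ss"
    and card: "\<And>t. card {i. i < m \<and> (\<exists>k\<in>K. run (schedule_of ss) i t = Some k)} \<le> c"
    and window: "\<And>s. s \<in> set ss \<Longrightarrow> seg_job s \<in> K \<Longrightarrow> a \<le> seg_start s \<and> seg_end s \<le> b"
    and "a \<le> b"
  shows "(\<Sum>s\<leftarrow>ss. (if seg_job s \<in> K then 1 else 0) * (seg_end s - seg_start s)) \<le> real c * (b - a)"
    (is "?len \<le> _")
proof -
  define h :: "segment \<Rightarrow> real" where "h = (\<lambda>s. if seg_job s \<in> K then 1 else 0)"
  have "(\<Sum>i<m. (case active ss i t of None \<Rightarrow> 0 | Some s \<Rightarrow> ennreal (h s))) \<le>
          ennreal (real c) * indicator {a..b} t" for t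
  proof -
    have eq: "(case active ss i t of None \<Rightarrow> 0 | Some s \<Rightarrow> ennreal (h s)) =
          (if \<exists>k\<in>K. run (schedule_of ss) i t = Some k then 1 else 0)" for i
      by (auto simp: h_def schedule_of_def split: option.splits)
    show ?thesis
    proof (cases "t \<in> {a..b}")
      case True
      have "(\<Sum>i<m. (if \<exists>k\<in>K. run (schedule_of ss) i t = Some k then 1 else (0::ennreal))) =
            (\<Sum>i\<in>{i. i < m \<and> (\<exists>k\<in>K. run (schedule_of ss) i t = Some k)}. 1)"
        by (intro sum.mono_neutral_cong_right) auto
      also have "\<dots> = of_nat (card {i. i < m \<and> (\<exists>k\<in>K. run (schedule_of ss) i t = Some k)})"
        by simp
      also have "\<dots> \<le> of_nat c" using card[of t] by simp
      finally show ?thesis using True by (simp add: eq ennreal_of_nat_eq_real_of_nat)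
    next
      case False
      hence "\<not> (\<exists>k\<in>K. run (schedule_of ss) i t = Some k)" for i
        using window by (force simp: schedule_of_def active_Some_iff[OF wf])
      thus ?thesis by (simp add: eq)
    qed
  qed
  hence "(\<integral>\<^sup>+t. (\<Sum>i<m. (case active ss i t of None \<Rightarrow> 0 | Some s \<Rightarrow> ennreal (h s))) \<partial>lborel) \<le>
         (\<integral>\<^sup>+t. ennreal (real c) * indicator {a..b} t \<partial>lborel)"
    by (intro nn_integral_mono) auto
  also have "\<dots> = ennreal (real c * (b - a))"
    using \<open>a \<le> b\<close> by (subst nn_integral_cmult_indicator) (auto simp: ennreal_mult)
  also have "(\<integral>\<^sup>+t. (\<Sum>i<m. (case active ss i t of None \<Rightarrow> 0 | Some s \<Rightarrow> ennreal (h s))) \<partial>lborel) =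
     (\<Sum>i<m. \<integral>\<^sup>+t. (case active ss i t of None \<Rightarrow> 0 | Some s \<Rightarrow> ennreal (h s)) \<partial>lborel)"
    by (intro nn_integral_sum) (use measurable_active[OF wf] in auto)
  also have "\<dots> = ennreal (\<Sum>s\<leftarrow>ss. h s * (seg_end s - seg_start s))"
    by (rule integral_active[OF wf]) (simp add: h_def)
  finally show ?thesis
    using \<open>a \<le> b\<close> unfolding h_def by (simp add: ennreal_le_iff)
qed

lemma exec_time_alt:
  "exec_time ss k = (\<Sum>s\<leftarrow>ss. (if seg_job s \<in> {k} then 1 else 0) * (seg_end s - seg_start s))"
  unfolding exec_time_def by (intro arg_cong[of _ _ sum_list] map_cong) auto

lemma exec_time_le_window:
  assumes wf: "wf_segments m ss" and feas: "preemptive_feasible m js (schedule_of ss)"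
    and valid: "valid_instance js" and j: "j \<in> set js"
  shows "exec_time ss (jid j) \<le> deadline j - release j"
proof -
  have "exec_time ss (jid j) \<le> real 1 * (deadline j - release j)"
    unfolding exec_time_alt
  proof (rule total_length_le[OF wf])
    fix t
    have "\<forall>i<m. \<forall>i'<m. \<forall>t k. run (schedule_of ss) i t = Some k \<and> run (schedule_of ss) i' t = Some k \<longrightarrow> i = i'"
      using feas unfolding preemptive_feasible_def by (elim conjE)
    hence "\<forall>x\<in>{i. i < m \<and> (\<exists>k\<in>{jid j}. run (schedule_of ss) i t = Some k)}.
           \<forall>y\<in>{i. i < m \<and> (\<exists>k\<in>{jid j}. run (schedule_of ss) i t = Some k)}. x = y"
      by blast
    thus "card {i. i < m \<and> (\<exists>k\<in>{jid j}. run (schedule_of ss) i t = Some k)} \<le> 1"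
      by (simp add: card_le_Suc0_iff_eq)
  next
    fix s assume "s \<in> set ss" "seg_job s \<in> {jid j}"
    thus "release j \<le> seg_start s \<and> seg_end s \<le> deadline j"
      using preemptive_feasible_schedule_ofD(1)[OF wf feas _ _ j] valid by (auto simp: valid_instance_def)
  qed (use valid j in \<open>auto simp: valid_instance_def intro: less_imp_le\<close>)
  thus ?thesis by simp
qed

lemma sum_list_indicator:
  fixes c :: "'b :: comm_monoid_add"
  assumes "distinct (map f xs)"
  shows "(\<Sum>x\<leftarrow>xs. if k = f x then c else 0) = (if k \<in> f ` set xs then c else 0)"
  using assms
proof (induction xs)
  case (Cons x xs)
  thus ?case by (auto simp: image_iff)
qed simp

lemma sum_list_swap:
  "(\<Sum>x\<leftarrow>xs. \<Sum>y\<leftarrow>ys. f x y) = (\<Sum>y\<leftarrow>ys. \<Sum>x\<leftarrow>xs. f x y)"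
  for f :: "_ \<Rightarrow> _ \<Rightarrow> 'a :: comm_monoid_add"
  by (induction xs) (auto simp: sum_list_addf)

lemma sum_exec_time:
  assumes "distinct (map jid js)"
  shows "(\<Sum>j\<leftarrow>js. exec_time ss (jid j)) =
         (\<Sum>s\<leftarrow>ss. (if seg_job s \<in> jid ` set js then 1 else 0) * (seg_end s - seg_start s))"
  unfolding exec_time_def
  by (subst sum_list_swap, intro arg_cong[of _ _ sum_list] map_cong refl)
     (simp add: sum_list_indicator[OF assms])

text \<open>The volume bound behind Graham's argument: jobs whose windows lie in
  \<open>[a, b]\<close> share the capacity of \<open>m\<close> processors during that
  interval.\<close>

lemma sum_exec_time_le:
  assumes wf: "wf_segments m ss" and feas: "preemptive_feasible m js (schedule_of ss)"
    and valid: "valid_instance js" and js': "set js' \<subseteq> set js" "distinct (map jid js')"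
    and window: "\<And>j. j \<in> set js' \<Longrightarrow> a \<le> release j \<and> deadline j \<le> b" and "a \<le> b"
  shows "(\<Sum>j\<leftarrow>js'. exec_time ss (jid j)) \<le> real m * (b - a)"
  unfolding sum_exec_time[OF js'(2)]
proof (rule total_length_le[OF wf])
  fix t
  have "card {i. i < m \<and> (\<exists>k\<in>jid ` set js'. run (schedule_of ss) i t = Some k)} \<le> card {..<m}"
    by (intro card_mono) auto
  thus "card {i. i < m \<and> (\<exists>k\<in>jid ` set js'. run (schedule_of ss) i t = Some k)} \<le> m"
    by simp
next
  fix s assume s: "s \<in> set ss" "seg_job s \<in> jid ` set js'"
  then obtain j where j: "j \<in> set js'" "jid j = seg_job s" by auto
  have "release j \<le> seg_start s \<and> seg_end s \<le> deadline j"
    using preemptive_feasible_schedule_ofD(1)[OF wf feas _ s(1) _ j(2)] valid j js'(1)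
    by (auto simp: valid_instance_def)
  thus "a \<le> seg_start s \<and> seg_end s \<le> b" using window[OF j(1)] by simp
qed fact

lemma exec_time_pos:
  assumes "\<And>s. s \<in> set ss \<Longrightarrow> seg_start s < seg_end s" and "0 < seg_work ss k"
  shows "0 < exec_time ss k"
proof -
  \<comment> \<open>Without a piece for \<open>k\<close> its work would be an empty contribution,
    hence 0.\<close>
  have "\<exists>s\<in>set ss. seg_job s = k"
  proof (rule ccontr)
    assume "\<not> (\<exists>s\<in>set ss. seg_job s = k)"
    hence "seg_work ss k = (\<Sum>s\<leftarrow>ss. 0)"
      unfolding seg_work_def by (intro arg_cong[of _ _ sum_list] map_cong) auto
    thus False using assms(2) by simp
  qed
  then obtain s where s: "s \<in> set ss" "seg_job s = k" by blast
  have "seg_end s - seg_start s \<le> exec_time ss k"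
    unfolding exec_time_def
    by (rule member_le_sum_list) (use s assms(1) in \<open>force intro: less_imp_le simp: image_iff\<close>)+
  thus ?thesis using assms(1)[OF s(1)] by simp
qed

section \<open>Energy as a function of execution time, and convexity\<close>

definition cost :: "real \<Rightarrow> real \<Rightarrow> real \<Rightarrow> real" where
  "cost \<alpha> w e = (w / e) powr \<alpha> * e"

text \<open>For positive arguments \<open>cost \<alpha> w e\<close> is
  \<open>w powr \<alpha> * e powr (1 - \<alpha>)\<close>, the energy of work \<open>w\<close> spread
  evenly over time \<open>e\<close>. Homogeneity of degree \<open>1 - \<alpha>\<close> in the time
  turns each loss of a factor in execution time into a power in the ratio.\<close>

lemma cost_divide:
  assumes "0 < c" "0 < w" "0 < e"
  shows "cost \<alpha> w (e / c) = c powr (\<alpha> - 1) * cost \<alpha> w e"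
proof -
  have "(w / (e / c)) powr \<alpha> = (w / e) powr \<alpha> * (c powr (\<alpha> - 1) * c)"
    using assms by (simp add: powr_diff powr_mult powr_divide)
  thus ?thesis using assms by (simp add: cost_def)
qed

lemma cost_antimono:
  assumes "1 \<le> \<alpha>" "0 < w" "0 < e" "e \<le> e'"
  shows "cost \<alpha> w e' \<le> cost \<alpha> w e"
proof -
  \<comment> \<open>The shorter time is the longer one divided by \<open>e' / e\<close>, which is at
    least 1.\<close>
  have "cost \<alpha> w e = (e' / e) powr (\<alpha> - 1) * cost \<alpha> w e'"
    using cost_divide[of "e' / e" w e' \<alpha>] assms by simp
  moreover have "1 \<le> (e' / e) powr (\<alpha> - 1)"
    using assms by (intro ge_one_powr_ge_zero) auto
  moreover have "0 \<le> cost \<alpha> w e'" using assms by (simp add: cost_def)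
  ultimately show ?thesis by (metis mult_right_mono mult_1)
qed

text \<open>The left side is the tangent of the power function at \<open>c\<close>. Young's
  inequality for \<open>x\<close> and \<open>c powr (\<alpha> - 1)\<close> with conjugate exponents
  \<open>\<alpha>\<close> and \<open>q\<close>, multiplied by \<open>\<alpha>\<close>, gives the
  bound without derivatives.\<close>

lemma powr_ge_tangent:
  fixes x c \<alpha> :: real
  assumes "1 < \<alpha>" "0 \<le> x" "0 < c"
  shows "\<alpha> * c powr (\<alpha> - 1) * x - (\<alpha> - 1) * c powr \<alpha> \<le> x powr \<alpha>"
proof -
  define q where "q = \<alpha> / (\<alpha> - 1)"
  have "x * c powr (\<alpha> - 1) \<le> x powr \<alpha> / \<alpha> + (c powr (\<alpha> - 1)) powr q / q"
    using assms by (intro Youngs_inequality) (auto simp: q_def field_simps)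
  also have "(c powr (\<alpha> - 1)) powr q = c powr \<alpha>"
    using assms by (simp add: powr_powr q_def)
  also have "c powr \<alpha> / q = (\<alpha> - 1) * c powr \<alpha> / \<alpha>"
    using assms by (simp add: q_def)
  finally show ?thesis using assms by (simp add: field_simps)
qed

text \<open>Jensen's inequality: among all ways to do the work within the same total execution time,
  constant speed is cheapest. The tangent at the average speed is summed over the pieces; being
  affine in the speed, it evaluates to exactly the energy at the average speed.\<close>

lemma cost_le_energy_of_job:
  assumes "1 < \<alpha>" and len: "\<And>s. s \<in> set ss \<Longrightarrow> seg_start s < seg_end s"
    and nonneg: "\<And>s. s \<in> set ss \<Longrightarrow> 0 \<le> seg_speed s" and "0 < seg_work ss k"
  shows "cost \<alpha> (seg_work ss k) (exec_time ss k) \<le>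
         (\<Sum>s\<leftarrow>ss. if seg_job s = k then seg_speed s powr \<alpha> * (seg_end s - seg_start s) else 0)"
proof -
  have e: "0 < exec_time ss k" using len assms(4) by (rule exec_time_pos)
  \<comment> \<open>The average speed of the job, which serves as the point of tangency.\<close>
  define c where "c = seg_work ss k / exec_time ss k"
  have c: "0 < c" "seg_work ss k = c * exec_time ss k" using e assms(4) by (auto simp: c_def)
  have "cost \<alpha> (seg_work ss k) (exec_time ss k) = c powr \<alpha> * exec_time ss k"
    by (simp add: cost_def c_def)
  also have "\<dots> = \<alpha> * c powr (\<alpha> - 1) * seg_work ss k - (\<alpha> - 1) * c powr \<alpha> * exec_time ss k"
    using c(1) by (simp add: c(2) powr_diff) (simp add: algebra_simps)
  also have "\<dots> = (\<Sum>s\<leftarrow>ss. \<alpha> * c powr (\<alpha> - 1) * ((if seg_job s = k then seg_speed s else 0) * (seg_end s - seg_start s))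
       - (\<alpha> - 1) * c powr \<alpha> * (if seg_job s = k then seg_end s - seg_start s else 0))"
    unfolding seg_work_def exec_time_def
    by (simp add: sum_list_subtractf sum_list_const_mult)
  also have "\<dots> \<le> (\<Sum>s\<leftarrow>ss. if seg_job s = k then seg_speed s powr \<alpha> * (seg_end s - seg_start s) else 0)"
  proof (rule sum_list_mono)
    fix s assume s: "s \<in> set ss"
    have "(\<alpha> * c powr (\<alpha> - 1) * seg_speed s - (\<alpha> - 1) * c powr \<alpha>) * (seg_end s - seg_start s)
       \<le> seg_speed s powr \<alpha> * (seg_end s - seg_start s)"
      using powr_ge_tangent[OF assms(1) nonneg[OF s] c(1)] len[OF s] by (intro mult_right_mono) auto
    thus "\<alpha> * c powr (\<alpha> - 1) * ((if seg_job s = k then seg_speed s else 0) * (seg_end s - seg_start s))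
       - (\<alpha> - 1) * c powr \<alpha> * (if seg_job s = k then seg_end s - seg_start s else 0) \<le>
       (if seg_job s = k then seg_speed s powr \<alpha> * (seg_end s - seg_start s) else 0)"
      by (simp add: algebra_simps)
  qed
  finally show ?thesis .
qed

lemma feasible_exec_time_pos:
  assumes "wf_segments m ss" "preemptive_feasible m js (schedule_of ss)" "valid_instance js" "j \<in> set js"
  shows "0 < exec_time ss (jid j)"
  using exec_time_pos[of ss "jid j"] wf_segmentsD(2)[OF assms(1)]
    preemptive_feasible_schedule_ofD(4)[OF assms(1,2,4)] assms(3,4)
  by (auto simp: valid_instance_def)

lemma sum_cost_le_seg_energy:
  assumes "1 < \<alpha>" and wf: "wf_segments m ss" and feas: "preemptive_feasible m js (schedule_of ss)"
    and valid: "valid_instance js"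
  shows "(\<Sum>j\<leftarrow>js. cost \<alpha> (work j) (exec_time ss (jid j))) \<le> seg_energy \<alpha> ss"
proof -
  have "(\<Sum>j\<leftarrow>js. cost \<alpha> (work j) (exec_time ss (jid j))) \<le>
        (\<Sum>j\<leftarrow>js. \<Sum>s\<leftarrow>ss. if seg_job s = jid j then seg_speed s powr \<alpha> * (seg_end s - seg_start s) else 0)"
  proof (rule sum_list_mono)
    fix j assume j: "j \<in> set js"
    have w: "0 < work j" using valid j by (simp add: valid_instance_def)
    have "seg_work ss (jid j) = work j"
      using preemptive_feasible_schedule_ofD(4)[OF wf feas j] w by simp
    thus "cost \<alpha> (work j) (exec_time ss (jid j)) \<le>
       (\<Sum>s\<leftarrow>ss. if seg_job s = jid j then seg_speed s powr \<alpha> * (seg_end s - seg_start s) else 0)"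
      using cost_le_energy_of_job[OF assms(1), of ss "jid j"] wf_segmentsD(2)[OF wf]
        preemptive_feasible_schedule_ofD(2)[OF wf feas] w by simp
  qed
  also have "\<dots> = (\<Sum>s\<leftarrow>ss. if seg_job s \<in> jid ` set js then seg_speed s powr \<alpha> * (seg_end s - seg_start s) else 0)"
    using valid by (subst sum_list_swap) (simp add: sum_list_indicator valid_instance_def)
  also have "\<dots> \<le> seg_energy \<alpha> ss"
    unfolding seg_energy_def
    by (rule sum_list_mono) (use wf_segmentsD(2)[OF wf] in \<open>force intro: less_imp_le\<close>)
  finally show ?thesis .
qed

section \<open>Common release dates and common deadlines\<close>

text \<open>Combinatorial form of a non-preemptive schedule. The equation of multisets encodes that
  every job has exactly one piece and that no other pieces occur; in this form schedules can be
  concatenated and permuted without any integral.\<close>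

definition one_piece :: "nat \<Rightarrow> job list \<Rightarrow> segment list \<Rightarrow> bool" where
  "one_piece m js ss \<longleftrightarrow> wf_segments m ss \<and> mset (map seg_job ss) = mset (map jid js) \<and>
     (\<forall>s\<in>set ss. \<exists>j\<in>set js. jid j = seg_job s \<and> release j \<le> seg_start s \<and> seg_end s \<le> deadline j \<and>
        0 \<le> seg_speed s \<and> seg_speed s * (seg_end s - seg_start s) = work j)"

lemma one_piece_Nil [simp]: "one_piece m [] []"
  by (simp add: one_piece_def)

lemma one_piece_append:
  assumes "one_piece m js ss" "one_piece m js' ss'"
    and "\<And>s s'. s \<in> set ss \<Longrightarrow> s' \<in> set ss' \<Longrightarrow> seg_end s \<le> seg_start s' \<or> seg_end s' \<le> seg_start s"
  shows "one_piece m (js @ js') (ss @ ss')"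
  unfolding one_piece_def
proof (intro conjI ballI)
  show "wf_segments m (ss @ ss')"
    using assms unfolding one_piece_def wf_segments_append by blast
  show "mset (map seg_job (ss @ ss')) = mset (map jid (js @ js'))"
    using assms unfolding one_piece_def by simp
  show "\<exists>j\<in>set (js @ js'). jid j = seg_job s \<and> release j \<le> seg_start s \<and> seg_end s \<le> deadline j \<and>
      0 \<le> seg_speed s \<and> seg_speed s * (seg_end s - seg_start s) = work j" if "s \<in> set (ss @ ss')" for s
    using assms(1,2) that unfolding one_piece_def set_append by blast
qed

lemma one_piece_cong_mset:
  assumes "one_piece m js ss" "mset js = mset js'"
  shows "one_piece m js' ss"
  using assms(1) unfolding one_piece_def mset_map assms(2) mset_eq_setD[OF assms(2)] .

text \<open>Carries a schedule for an instance with shrunken windows back to the instance from which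
  the windows came.\<close>

lemma one_piece_widen:
  assumes "one_piece m (map f js) ss"
    and "\<And>j. j \<in> set js \<Longrightarrow> jid (f j) = jid j \<and> work (f j) = work j \<and>
       release j \<le> release (f j) \<and> deadline (f j) \<le> deadline j"
  shows "one_piece m js ss"
proof -
  have "map jid (map f js) = map jid js" using assms(2) by simp
  moreover have "\<exists>j\<in>set js. jid j = seg_job s \<and> release j \<le> seg_start s \<and> seg_end s \<le> deadline j \<and>
        0 \<le> seg_speed s \<and> seg_speed s * (seg_end s - seg_start s) = work j" if "s \<in> set ss" for s
  proof -
    have "\<exists>x\<in>set (map f js). jid x = seg_job s \<and> release x \<le> seg_start s \<and> seg_end s \<le> deadline x \<and>
        0 \<le> seg_speed s \<and> seg_speed s * (seg_end s - seg_start s) = work x"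
      using assms(1) that unfolding one_piece_def by (elim conjE) (rule bspec)
    then obtain j where "j \<in> set js" "jid (f j) = seg_job s" "release (f j) \<le> seg_start s"
      "seg_end s \<le> deadline (f j)" "0 \<le> seg_speed s" "seg_speed s * (seg_end s - seg_start s) = work (f j)"
      by auto
    thus ?thesis using assms(2)[of j] by (intro bexI[of _ j]) auto
  qed
  moreover have "wf_segments m ss" "mset (map seg_job ss) = mset (map jid (map f js))"
    using assms(1) unfolding one_piece_def by blast+
  ultimately show ?thesis unfolding one_piece_def by metis
qed

text \<open>Identifiers of a valid instance are distinct, so the multiset equation gives each job a
  unique piece. Its running times are then that one interval, and its work is the work of that piece
  alone.\<close>

lemma one_piece_nonpreemptive_feasible:
  assumes op: "one_piece m js ss" and valid: "valid_instance js"
  shows "nonpreemptive_feasible m js (schedule_of ss)"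
proof -
  have wf: "wf_segments m ss" and ids: "mset (map seg_job ss) = mset (map jid js)"
    and seg: "\<And>s. s \<in> set ss \<Longrightarrow> \<exists>j\<in>set js. jid j = seg_job s \<and> release j \<le> seg_start s \<and>
        seg_end s \<le> deadline j \<and> 0 \<le> seg_speed s \<and> seg_speed s * (seg_end s - seg_start s) = work j"
    using op unfolding one_piece_def by auto
  have dist: "distinct (map seg_job ss)"
    using ids valid mset_eq_imp_distinct_iff unfolding valid_instance_def by blast
  hence inj: "s = s'" if "s \<in> set ss" "s' \<in> set ss" "seg_job s = seg_job s'" for s s'
    using that by (auto simp: distinct_map dest: inj_onD)
  have ex: "\<exists>s\<in>set ss. seg_job s = jid j" if "j \<in> set js" for j
    using mset_eq_setD[OF ids] that by (metis imageE imageI list.set_map)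
  have works: "seg_work ss (jid j) = work j" if j: "j \<in> set js" for j
  proof -
    obtain s where s: "s \<in> set ss" "seg_job s = jid j" using ex[OF j] by blast
    obtain j' where j': "j' \<in> set js" "jid j' = seg_job s" "seg_speed s * (seg_end s - seg_start s) = work j'"
      using seg[OF s(1)] by blast
    have "j' = j" using j' j s valid unfolding valid_instance_def by (metis distinct_map inj_onD)
    have "seg_work ss (jid j) = (\<Sum>s'\<leftarrow>ss. if seg_job s = seg_job s' then work j else 0)"
      unfolding seg_work_def
    proof (intro arg_cong[of _ _ sum_list] map_cong refl)
      fix s' assume "s' \<in> set ss"
      thus "(if seg_job s' = jid j then seg_speed s' else 0) * (seg_end s' - seg_start s') =
          (if seg_job s = seg_job s' then work j else 0)"
        using s inj[of s' s] j'(3) \<open>j' = j\<close> by (cases "seg_job s' = jid j") auto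
    qed
    thus ?thesis using s(1) by (simp add: sum_list_indicator[OF dist])
  qed
  have "preemptive_feasible m js (schedule_of ss)"
  proof (rule preemptive_feasible_schedule_ofI[OF wf])
    fix s assume "s \<in> set ss"
    with seg[OF this] show "0 \<le> seg_speed s"
      "\<exists>j\<in>set js. jid j = seg_job s \<and> release j \<le> seg_start s \<and> seg_end s \<le> deadline j" by auto
  qed (use inj works in auto)
  moreover have "\<exists>i<m. \<exists>a b. \<forall>i'<m. \<forall>t.
        run (schedule_of ss) i' t = Some (jid j) \<longleftrightarrow> i' = i \<and> a \<le> t \<and> t < b" if j: "j \<in> set js" for j
  proof -
    obtain s where s: "s \<in> set ss" "seg_job s = jid j" using ex[OF j] by blast
    have "run (schedule_of ss) i' t = Some (jid j) \<longleftrightarrow>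
        i' = seg_proc s \<and> seg_start s \<le> t \<and> t < seg_end s" for i' t
    proof
      assume "run (schedule_of ss) i' t = Some (jid j)"
      then obtain s' where s': "s' \<in> set ss" "running s' i' t" "seg_job s' = jid j"
        by (auto simp: schedule_of_def active_Some_iff[OF wf])
      with s inj[of s' s] have "s' = s" by simp
      with s' show "i' = seg_proc s \<and> seg_start s \<le> t \<and> t < seg_end s" by simp
    next
      assume "i' = seg_proc s \<and> seg_start s \<le> t \<and> t < seg_end s"
      hence "active ss i' t = Some s" using s by (simp add: active_Some_iff[OF wf])
      thus "run (schedule_of ss) i' t = Some (jid j)" using s by (simp add: schedule_of_def)
    qed
    thus ?thesis using wf_segmentsD(1)[OF wf s(1)] by blast
  qed
  ultimately show ?thesis unfolding nonpreemptive_feasible_def by blast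
qed

section \<open>Start times and energy of list schedules\<close>

lemma length_proc_times [simp]: "length (proc_times opt m js) = length js"
  by (simp add: proc_times_def Let_def)

lemma init_procs_props:
  assumes "js \<noteq> []" "1 \<le> m"
  shows "init_procs m t js \<noteq> []" "distinct (map fst (init_procs m t js))"
    "\<forall>q\<in>set (init_procs m t js). fst q < m"
    "length (init_procs m t js) = min m (length js)"
    "(\<Sum>q\<leftarrow>init_procs m t js. snd q) = real (min m (length js)) * t"
    "filter (\<lambda>q. snd q \<le> t) (init_procs m t js) = init_procs m t js"
    "map (apsnd uminus) (init_procs m t js) = init_procs m (- t) js"
    "\<And>q. q \<in> set (init_procs m t js) \<Longrightarrow> snd q = t"
  using assms by (auto simp: init_procs_def comp_def sum_list_triv)

text \<open>The state holds \<open>min m (length js)\<close> processors. If this is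
  \<open>m\<close>, the average load bounds the start time. Otherwise there is a processor for each
  job, all jobs start at \<open>R\<close>, and the bound holds because processing times are
  nonnegative.\<close>

lemma forward_init_procs_bounds:
  assumes "1 \<le> m" "length jps = length js" and pos: "\<forall>q\<in>set jps. 0 < snd q"
    and s: "s \<in> set (forward jps (init_procs m R js))"
  obtains xs j p ys where "jps = xs @ (j, p) # ys" "seg_job s = jid j" "seg_end s = seg_start s + p"
    "seg_speed s = work j / p" "R \<le> seg_start s" "seg_start s \<le> R + (\<Sum>q\<leftarrow>xs. snd q) / real m"
proof -
  have js: "js \<noteq> []" using assms(2) s by auto
  note ip = init_procs_props[OF js assms(1)]
  obtain xs j p ys where *: "jps = xs @ (j, p) # ys" "seg_job s = jid j" "seg_end s = seg_start s + p"
      "seg_speed s = work j / p"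
      "real (length (init_procs m R js)) * seg_start s \<le>
        (\<Sum>q\<leftarrow>init_procs m R js. snd q) + (\<Sum>q\<leftarrow>xs. snd q)"
      "length jps \<le> length (filter (\<lambda>q. snd q \<le> R) (init_procs m R js)) \<longrightarrow> seg_start s \<le> R"
    using forward_bounds[OF ip(1,2) s] by blast
  have "R \<le> seg_start s"
    using forward_starts_after_free[OF ip(1,2) pos s] ip(8) by fastforce
  moreover have "seg_start s \<le> R + (\<Sum>q\<leftarrow>xs. snd q) / real m"
  proof (cases "m \<le> length js")
    case True
    thus ?thesis using *(5) \<open>1 \<le> m\<close> by (simp add: ip min_def field_simps)
  next
    case False
    hence "seg_start s \<le> R" using *(6) assms(2) by (simp add: ip)
    moreover have "0 \<le> (\<Sum>q\<leftarrow>xs. snd q)" using pos *(1) by (intro sum_list_nonneg) (auto intro: less_imp_le)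
    ultimately show ?thesis by (simp add: add_increasing2)
  qed
  ultimately show ?thesis using * that by blast
qed

text \<open>Job, length and speed of a piece do not depend on where it is placed. Energy and the
  multiset of scheduled jobs are functions of these data only, so they can be computed from the list
  of jobs.\<close>

lemma forward_shape:
  "map (\<lambda>s. (seg_job s, seg_end s - seg_start s, seg_speed s)) (forward jps ps) =
   map (\<lambda>(j, p). (jid j, p, work j / p)) jps"
  by (induction jps ps rule: forward.induct) (auto simp: Let_def split: prod.splits)

lemma backward_shape:
  assumes "ps \<noteq> [] \<or> jps = []"
  shows "map (\<lambda>s. (seg_job s, seg_end s - seg_start s, seg_speed s)) (backward jps ps) =
   map (\<lambda>(j, p). (jid j, p, work j / p)) jps"
  using assms forward_shape[of jps "map (apsnd uminus) ps"]
  by (auto simp: backward_eq_mirror_forward comp_def)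

lemma seg_energy_of_shape:
  assumes "map (\<lambda>s. (seg_job s, seg_end s - seg_start s, seg_speed s)) ss =
      map (\<lambda>(j, p). (jid j, p, work j / p)) jps"
    and "mset jps = mset (map (\<lambda>j. (j, p j)) js)"
  shows "seg_energy \<alpha> ss = (\<Sum>j\<leftarrow>js. cost \<alpha> (work j) (p j))"
    and "mset (map seg_job ss) = mset (map jid js)"
proof -
  have "seg_energy \<alpha> ss = (\<Sum>(k, l, v)\<leftarrow>map (\<lambda>s. (seg_job s, seg_end s - seg_start s, seg_speed s)) ss. v powr \<alpha> * l)"
    by (simp add: seg_energy_def comp_def)
  also have "\<dots> = (\<Sum>(j, p)\<leftarrow>jps. cost \<alpha> (work j) p)"
    unfolding assms(1) by (simp add: cost_def comp_def case_prod_unfold)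
  also have "\<dots> = (\<Sum>j\<leftarrow>js. cost \<alpha> (work j) (p j))"
    by (subst sum_list_cong_mset[OF assms(2)]) (simp add: comp_def)
  finally show "seg_energy \<alpha> ss = (\<Sum>j\<leftarrow>js. cost \<alpha> (work j) (p j))" .
  have "map seg_job ss = map fst (map (\<lambda>s. (seg_job s, seg_end s - seg_start s, seg_speed s)) ss)"
    by simp
  also have "\<dots> = map (jid \<circ> fst) jps" unfolding assms(1) by auto
  finally have "mset (map seg_job ss) = image_mset (jid \<circ> fst) (mset jps)" by simp
  also have "\<dots> = mset (map jid js)" unfolding assms(2) by (simp add: multiset.map_comp comp_def)
  finally show "mset (map seg_job ss) = mset (map jid js)" .
qed

text \<open>Here \<open>P\<close> is the load placed before a job, \<open>p\<close> its own
  processing time and \<open>W\<close> the length of its window. Writing \<open>P / m + p\<close> as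
  \<open>(P + p) / m + (1 - 1 / m) * p\<close>, the volume bound limits the first term and the
  window limits the second; the constant arises as
  \<open>1 + (1 - 1 / m) = 2 - 1 / m\<close>.\<close>

lemma graham_bound:
  fixes P p W :: real
  assumes "1 \<le> m" and "(P + p) * (2 - 1 / real m) \<le> real m * W" and "p * (2 - 1 / real m) \<le> W"
  shows "P / real m + p \<le> W"
proof -
  define c where "c = 2 - 1 / real m"
  have m: "1 / real m \<le> 1" using assms(1) by simp
  hence c: "0 < c" by (simp add: c_def)
  have "(P / real m + p) * c = ((P + p) * c) / real m + (1 - 1 / real m) * (p * c)"
    using assms(1) by (simp add: field_simps)
  also have "\<dots> \<le> (real m * W) / real m + (1 - 1 / real m) * W"
    using assms m unfolding c_def by (intro add_mono divide_right_mono mult_left_mono) auto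
  also have "\<dots> = W * c" using assms(1) by (simp add: c_def field_simps)
  finally show ?thesis using c by simp
qed

lemma wf_segments_mirror: "wf_segments m ss \<Longrightarrow> wf_segments m (map seg_mirror ss)"
  by (induction ss) (auto simp: wf_segments_Cons)

section \<open>The two list schedulers on one fixed instance\<close>

context
  fixes m :: nat and js :: "job list" and opt :: "nat \<Rightarrow> job list \<Rightarrow> segment list" and c :: real
  assumes m: "1 \<le> m" and valid: "valid_instance js"
    and wf: "wf_segments m (opt m js)" and feas: "preemptive_feasible m js (schedule_of (opt m js))"
  defines "c \<equiv> 2 - 1 / real m"
begin

lemma speedup_ge_1: "1 \<le> c"
  using m by (simp add: c_def)

lemma proc_times_eq: "proc_times opt m js = map (\<lambda>j. (j, exec_time (opt m js) (jid j) / c)) js"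
  by (simp add: proc_times_def c_def Let_def)

lemma proc_times_pos:
  assumes "mset jps = mset (proc_times opt m js)"
  shows "\<forall>q\<in>set jps. 0 < snd q"
  using mset_eq_setD[OF assms] feasible_exec_time_pos[OF wf feas valid] speedup_ge_1
  by (auto simp: proc_times_eq)

text \<open>Since the windows of the jobs in \<open>xs\<close> lie inside that of \<open>j\<close>,
  their unshortened execution times and that of \<open>j\<close> fit into this window on
  \<open>m\<close> processors. The hypothesis on nested windows is what both orders, by deadline
  with a common release date and by release date with a common deadline, provide.\<close>

lemma proc_times_bounds:
  assumes jps: "mset (xs @ (j, p) # ys) = mset (proc_times opt m js)"
    and win: "\<And>j'. j' \<in> fst ` set xs \<Longrightarrow> release j \<le> release j' \<and> deadline j' \<le> deadline j"
  shows "j \<in> set js" "0 < p" "(\<Sum>q\<leftarrow>xs. snd q) / real m + p \<le> deadline j - release j"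
proof -
  have mem: "fst q \<in> set js \<and> snd q = exec_time (opt m js) (jid (fst q)) / c"
    if "q \<in> set (xs @ (j, p) # ys)" for q
    using that unfolding mset_eq_setD[OF jps] by (auto simp: proc_times_eq)
  show j: "j \<in> set js" using mem[of "(j, p)"] by simp
  show "0 < p" using proc_times_pos[OF jps] by simp
  have "mset (map (jid \<circ> fst) (xs @ (j, p) # ys)) = mset (map (jid \<circ> fst) (proc_times opt m js))"
    using jps by (metis mset_map)
  also have "map (jid \<circ> fst) (proc_times opt m js) = map jid js"
    by (simp add: proc_times_eq)
  finally have "distinct (map (jid \<circ> fst) (xs @ (j, p) # ys))"
    using valid mset_eq_imp_distinct_iff unfolding valid_instance_def by blast
  hence dist: "distinct (map jid (map fst (xs @ [(j, p)])))" by simp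
  have "(\<Sum>j\<leftarrow>map fst (xs @ [(j, p)]). exec_time (opt m js) (jid j)) \<le> real m * (deadline j - release j)"
  proof (rule sum_exec_time_le[OF wf feas valid _ dist])
    show "set (map fst (xs @ [(j, p)])) \<subseteq> set js" using mem j by fastforce
    show "release j \<le> release j' \<and> deadline j' \<le> deadline j" if "j' \<in> set (map fst (xs @ [(j, p)]))" for j'
      using that win by auto
    show "release j \<le> deadline j" using valid j by (auto simp: valid_instance_def intro: less_imp_le)
  qed
  also have "(\<Sum>j\<leftarrow>map fst (xs @ [(j, p)]). exec_time (opt m js) (jid j)) = (\<Sum>q\<leftarrow>xs @ [(j, p)]. snd q * c)"
    using mem speedup_ge_1 unfolding map_map
    by (intro arg_cong[of _ _ sum_list] map_cong refl) force
  also have "\<dots> = ((\<Sum>q\<leftarrow>xs. snd q) + p) * c"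
    by (simp add: sum_list_mult_const distrib_right)
  finally have "((\<Sum>q\<leftarrow>xs. snd q) + p) * c \<le> real m * (deadline j - release j)" .
  moreover have "p * c \<le> deadline j - release j"
    using mem[of "(j, p)"] exec_time_le_window[OF wf feas valid j] speedup_ge_1 by simp
  ultimately show "(\<Sum>q\<leftarrow>xs. snd q) / real m + p \<le> deadline j - release j"
    unfolding c_def by (rule graham_bound[OF m])
qed

lemma crd_correct:
  assumes R: "\<And>j. j \<in> set js \<Longrightarrow> release j = R"
  shows "one_piece m js (crd opt m R js)"
    and "seg_energy \<alpha> (crd opt m R js) = (\<Sum>j\<leftarrow>js. cost \<alpha> (work j) (exec_time (opt m js) (jid j) / c))"
proof -
  define jps where "jps = sort_key (\<lambda>q. deadline (fst q)) (proc_times opt m js)"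
  have ms: "mset jps = mset (proc_times opt m js)" by (simp add: jps_def)
  have len: "length jps = length js" by (simp add: jps_def)
  have crd: "crd opt m R js = forward jps (init_procs m R js)" by (simp add: crd_def jps_def)
  note shape = seg_energy_of_shape[OF forward_shape ms[unfolded proc_times_eq]]
  show "seg_energy \<alpha> (crd opt m R js) = (\<Sum>j\<leftarrow>js. cost \<alpha> (work j) (exec_time (opt m js) (jid j) / c))"
    unfolding crd by (rule shape(1))
  show "one_piece m js (crd opt m R js)"
  proof (cases "js = []")
    case True
    thus ?thesis using len unfolding crd by simp
  next
    case False
    note ip = init_procs_props[OF False m]
    note pos = proc_times_pos[OF ms]
    have "\<exists>j\<in>set js. jid j = seg_job s \<and> release j \<le> seg_start s \<and> seg_end s \<le> deadline j \<and>
        0 \<le> seg_speed s \<and> seg_speed s * (seg_end s - seg_start s) = work j"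
      if s: "s \<in> set (forward jps (init_procs m R js))" for s
    proof -
      obtain xs j p ys where *: "jps = xs @ (j, p) # ys" "seg_job s = jid j" "seg_end s = seg_start s + p"
        "seg_speed s = work j / p" "R \<le> seg_start s" "seg_start s \<le> R + (\<Sum>q\<leftarrow>xs. snd q) / real m"
        using forward_init_procs_bounds[OF m len pos s] by blast
      have "sorted (map (\<lambda>q. deadline (fst q)) jps)" by (simp add: jps_def)
      \<comment> \<open>Together with the common release date, the deadline order nests the windows
        of all predecessors in the window of \<open>j\<close>.\<close>
      hence sorted: "\<forall>x\<in>set xs. deadline (fst x) \<le> deadline j" unfolding *(1) by (simp add: sorted_append)
      have "fst ` set jps = set js" unfolding mset_eq_setD[OF ms] proc_times_eq by force
      hence "j \<in> set js" "fst ` set xs \<subseteq> set js" unfolding *(1) by auto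
      hence "release j \<le> release j' \<and> deadline j' \<le> deadline j" if "j' \<in> fst ` set xs" for j'
        using that R sorted by auto
      note b = proc_times_bounds[OF ms[unfolded *(1)] this]
      have "0 < work j" using b(1) valid by (simp add: valid_instance_def)
      thus ?thesis using * b R[OF b(1)] by (intro bexI[OF _ b(1)]) auto
    qed
    thus ?thesis
      unfolding one_piece_def crd using wf_segments_forward[OF ip(1,2) pos ip(3)] shape(2) by blast
  qed
qed

lemma cd_correct:
  assumes D: "\<And>j. j \<in> set js \<Longrightarrow> deadline j = D"
  shows "one_piece m js (cd opt m D js)"
    and "seg_energy \<alpha> (cd opt m D js) = (\<Sum>j\<leftarrow>js. cost \<alpha> (work j) (exec_time (opt m js) (jid j) / c))"
proof -
  define jps where "jps = sort_key (\<lambda>q. - release (fst q)) (proc_times opt m js)"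
  have ms: "mset jps = mset (proc_times opt m js)" by (simp add: jps_def)
  have len: "length jps = length js" by (simp add: jps_def)
  have cd: "cd opt m D js = backward jps (init_procs m D js)" by (simp add: cd_def jps_def)
  have "init_procs m D js \<noteq> [] \<or> jps = []"
    using len m init_procs_props(1) by (cases "js = []") auto
  note shape = seg_energy_of_shape[OF backward_shape[OF this] ms[unfolded proc_times_eq]]
  show "seg_energy \<alpha> (cd opt m D js) = (\<Sum>j\<leftarrow>js. cost \<alpha> (work j) (exec_time (opt m js) (jid j) / c))"
    unfolding cd by (rule shape(1))
  show "one_piece m js (cd opt m D js)"
  proof (cases "js = []")
    case True
    thus ?thesis using len unfolding cd by simp
  next
    case False
    note ip = init_procs_props[OF False m]
    note pos = proc_times_pos[OF ms]
    \<comment> \<open>In reversed time the common deadline \<open>D\<close> plays the role of a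
      common release date \<open>- D\<close>, so the forward bounds apply. A completion time in
      reversed time is the negative of a start time.\<close>
    have bwd: "backward jps (init_procs m D js) = map seg_mirror (forward jps (init_procs m (- D) js))"
      using ip by (simp add: backward_eq_mirror_forward)
    have "\<exists>j\<in>set js. jid j = seg_job s \<and> release j \<le> seg_start s \<and> seg_end s \<le> deadline j \<and>
        0 \<le> seg_speed s \<and> seg_speed s * (seg_end s - seg_start s) = work j"
      if s: "s \<in> set (map seg_mirror (forward jps (init_procs m (- D) js)))" for s
    proof -
      obtain s' where s': "s' \<in> set (forward jps (init_procs m (- D) js))" "s = seg_mirror s'"
        using s by auto
      obtain xs j p ys where *: "jps = xs @ (j, p) # ys" "seg_job s' = jid j" "seg_end s' = seg_start s' + p"
        "seg_speed s' = work j / p" "- D \<le> seg_start s'" "seg_start s' \<le> - D + (\<Sum>q\<leftarrow>xs. snd q) / real m"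
        using forward_init_procs_bounds[OF m len pos s'(1)] by blast
      have "sorted (map (\<lambda>q. - release (fst q)) jps)" by (simp add: jps_def)
      hence sorted: "\<forall>x\<in>set xs. - release (fst x) \<le> - release j" unfolding *(1) by (simp add: sorted_append)
      have "fst ` set jps = set js" unfolding mset_eq_setD[OF ms] proc_times_eq by force
      hence "j \<in> set js" "fst ` set xs \<subseteq> set js" unfolding *(1) by auto
      hence "release j \<le> release j' \<and> deadline j' \<le> deadline j" if "j' \<in> fst ` set xs" for j'
        using that D sorted by auto
      note b = proc_times_bounds[OF ms[unfolded *(1)] this]
      have "0 < work j" using b(1) valid by (simp add: valid_instance_def)
      thus ?thesis using * b D[OF b(1)] s'(2) by (intro bexI[OF _ b(1)]) auto
    qed
    moreover have "wf_segments m (map seg_mirror (forward jps (init_procs m (- D) js)))"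
      by (rule wf_segments_mirror, rule wf_segments_forward) (use init_procs_props[OF False m] pos in auto)
    ultimately show ?thesis
      unfolding one_piece_def cd bwd using shape(2)[unfolded bwd] by blast
  qed
qed

end

section \<open>Cliques\<close>

text \<open>Common form of \<open>exec_before\<close> and \<open>exec_after\<close>: each is the
  case in which one end of the interval lies beyond all segments. Both halves of a clique can thus
  be treated by the same lemmas.\<close>

definition clip_time :: "real \<Rightarrow> real \<Rightarrow> segment list \<Rightarrow> nat \<Rightarrow> real" where
  "clip_time a b ss k =
     (\<Sum>s\<leftarrow>ss. if seg_job s = k then max 0 (min (seg_end s) b - max (seg_start s) a) else 0)"

lemma clip_time_posE:
  assumes "0 < clip_time a b ss k"
  obtains s where "s \<in> set ss" "seg_job s = k" "max (seg_start s) a < min (seg_end s) b"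
proof -
  have "\<exists>s\<in>set ss. seg_job s = k \<and> max (seg_start s) a < min (seg_end s) b"
  proof (rule ccontr)
    assume *: "\<not> ?thesis"
    have "clip_time a b ss k \<le> (\<Sum>s\<leftarrow>ss. 0)"
      unfolding clip_time_def
    proof (rule sum_list_mono)
      fix s assume "s \<in> set ss"
      with * show "(if seg_job s = k then max 0 (min (seg_end s) b - max (seg_start s) a) else 0) \<le> 0"
        by (cases "seg_job s = k") auto
    qed
    thus False using assms by simp
  qed
  thus ?thesis using that by blast
qed

lemma exec_before_eq_clip_time:
  assumes "\<And>s. s \<in> set ss \<Longrightarrow> a \<le> seg_start s"
  shows "exec_before T ss k = clip_time a T ss k"
  unfolding exec_before_def clip_time_def
proof (intro arg_cong[of _ _ sum_list] map_cong refl)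
  fix s assume "s \<in> set ss"
  hence "max (seg_start s) a = seg_start s" by (rule max_absorb1[OF assms])
  thus "(if seg_job s = k then max 0 (min (seg_end s) T - seg_start s) else 0) =
     (if seg_job s = k then max 0 (min (seg_end s) T - max (seg_start s) a) else 0)" by simp
qed

lemma exec_after_eq_clip_time:
  assumes "\<And>s. s \<in> set ss \<Longrightarrow> seg_end s \<le> b"
  shows "exec_after T ss k = clip_time T b ss k"
  unfolding exec_after_def clip_time_def
proof (intro arg_cong[of _ _ sum_list] map_cong refl)
  fix s assume "s \<in> set ss"
  hence "min (seg_end s) b = seg_end s" by (rule min_absorb1[OF assms])
  thus "(if seg_job s = k then max 0 (seg_end s - max (seg_start s) T) else 0) =
     (if seg_job s = k then max 0 (min (seg_end s) b - max (seg_start s) T) else 0)" by simp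
qed

lemma exec_time_eq_before_plus_after:
  assumes "\<And>s. s \<in> set ss \<Longrightarrow> seg_start s < seg_end s"
  shows "exec_time ss k = exec_before T ss k + exec_after T ss k"
  unfolding exec_time_def exec_before_def exec_after_def sum_list_addf[symmetric]
proof (intro arg_cong[of _ _ sum_list] map_cong refl)
  fix s assume "s \<in> set ss"
  hence "seg_start s < seg_end s" by (rule assms)
  thus "(if seg_job s = k then seg_end s - seg_start s else 0) =
    (if seg_job s = k then max 0 (min (seg_end s) T - seg_start s) else 0) +
    (if seg_job s = k then max 0 (seg_end s - max (seg_start s) T) else 0)"
    by (simp add: min_def max_def)
qed

text \<open>Running every job of \<open>js'\<close> at constant speed exactly when it is executed during \<open>[a, b)\<close>.\<close>

definition clip :: "real \<Rightarrow> real \<Rightarrow> job list \<Rightarrow> segment list \<Rightarrow> segment list" where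
  "clip a b js' ss =
     map (\<lambda>s. Seg (seg_job s) (seg_proc s) (max (seg_start s) a) (min (seg_end s) b)
                (seg_work ss (seg_job s) / clip_time a b ss (seg_job s)))
       (filter (\<lambda>s. seg_job s \<in> jid ` set js' \<and> max (seg_start s) a < min (seg_end s) b) ss)"

text \<open>Clipped pieces are subintervals of old ones, so they inherit disjointness and lie in the
  clipped windows. Spreading the whole work of a job evenly over its retained time completes it, and
  constant speed makes the energy equal to \<open>cost\<close> rather than merely bounded by
  it.\<close>

lemma clip_correct:
  assumes wf: "wf_segments m ss" and feas: "preemptive_feasible m js (schedule_of ss)"
    and valid: "valid_instance js" and dist: "distinct (map jid js')"
    and js': "\<And>j'. j' \<in> set js' \<Longrightarrow> \<exists>j\<in>set js. jid j = jid j' \<and> work j = work j' \<and>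
       release j' \<le> max (release j) a \<and> min (deadline j) b \<le> deadline j'"
    and pos: "\<And>j'. j' \<in> set js' \<Longrightarrow> 0 < clip_time a b ss (jid j')"
  shows "wf_segments m (clip a b js' ss)"
    and "preemptive_feasible m js' (schedule_of (clip a b js' ss))"
    and "seg_energy \<alpha> (clip a b js' ss) = (\<Sum>j\<leftarrow>js'. cost \<alpha> (work j) (clip_time a b ss (jid j)))"
proof -
  note D = preemptive_feasible_schedule_ofD[OF wf feas]
  have work_js': "seg_work ss (jid j') = work j'" "0 < work j'" if j': "j' \<in> set js'" for j'
  proof -
    obtain j where j: "j \<in> set js" "jid j = jid j'" "work j = work j'" using js'[OF j'] by blast
    show "0 < work j'" using valid j by (simp add: valid_instance_def flip: j(3))
    thus "seg_work ss (jid j') = work j'" using D(4)[OF j(1)] j by simp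
  qed
  \<comment> \<open>With \<open>f\<close> the power of the speed this computes the energy; with
    \<open>f\<close> selecting a single job it computes the work of that job.\<close>
  have sum_clip: "(\<Sum>s\<leftarrow>clip a b js' ss. f (seg_job s) (seg_speed s) * (seg_end s - seg_start s)) =
      (\<Sum>j\<leftarrow>js'. f (jid j) (work j / clip_time a b ss (jid j)) * clip_time a b ss (jid j))"
    (is "?L = ?R") for f
  proof -
    define g where "g k = f k (seg_work ss k / clip_time a b ss k)" for k
    have "?L = (\<Sum>s\<leftarrow>ss. if seg_job s \<in> jid ` set js' then
           g (seg_job s) * max 0 (min (seg_end s) b - max (seg_start s) a) else 0)"
      unfolding clip_def map_map comp_def segment.sel sum_list_map_filter' g_def
      by (intro arg_cong[of _ _ sum_list] map_cong refl) (auto simp: max_def)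
    also have "\<dots> = (\<Sum>j\<leftarrow>js'. \<Sum>s\<leftarrow>ss. if seg_job s = jid j then
           g (seg_job s) * max 0 (min (seg_end s) b - max (seg_start s) a) else 0)"
      by (subst sum_list_swap) (simp add: sum_list_indicator[OF dist])
    also have "\<dots> = (\<Sum>j\<leftarrow>js'. g (jid j) * clip_time a b ss (jid j))"
      unfolding clip_time_def sum_list_const_mult[symmetric]
      by (intro arg_cong[of _ _ sum_list] map_cong refl) auto
    also have "\<dots> = ?R"
      by (intro arg_cong[of _ _ sum_list] map_cong refl) (simp add: g_def work_js')
    finally show ?thesis .
  qed
  show "seg_energy \<alpha> (clip a b js' ss) = (\<Sum>j\<leftarrow>js'. cost \<alpha> (work j) (clip_time a b ss (jid j)))"
    using sum_clip[of "\<lambda>_ v. v powr \<alpha>"] by (simp add: seg_energy_def cost_def)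
  \<comment> \<open>The speeds in \<open>clip\<close> depend on the whole list \<open>ss\<close>, so
    they are abstracted to \<open>v\<close> before the induction on the list.\<close>
  have "wf_segments m ss' \<Longrightarrow> wf_segments m (map (\<lambda>s. Seg (seg_job s) (seg_proc s) (max (seg_start s) a)
      (min (seg_end s) b) (v s)) (filter (\<lambda>s. P s \<and> max (seg_start s) a < min (seg_end s) b) ss'))"
    for P v ss'
    by (induction ss') (auto simp: wf_segments_Cons)
  from this[OF wf] show wf': "wf_segments m (clip a b js' ss)"
    unfolding clip_def .
  have mem: "\<exists>s\<in>set ss. seg_job s' = seg_job s \<and> seg_proc s' = seg_proc s \<and> seg_job s \<in> jid ` set js' \<and>
      seg_start s' = max (seg_start s) a \<and> seg_end s' = min (seg_end s) b \<and>
      seg_speed s' = seg_work ss (seg_job s) / clip_time a b ss (seg_job s)"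
    if s': "s' \<in> set (clip a b js' ss)" for s'
  proof -
    obtain s where "s \<in> set ss" "seg_job s \<in> jid ` set js'"
      "s' = Seg (seg_job s) (seg_proc s) (max (seg_start s) a) (min (seg_end s) b)
                (seg_work ss (seg_job s) / clip_time a b ss (seg_job s))"
      using s' unfolding clip_def set_map set_filter by blast
    thus ?thesis by (intro bexI[of _ s]) simp_all
  qed
  show "preemptive_feasible m js' (schedule_of (clip a b js' ss))"
  proof (rule preemptive_feasible_schedule_ofI[OF wf'])
    fix s' assume "s' \<in> set (clip a b js' ss)"
    from mem[OF this] obtain s j' where s: "s \<in> set ss" "seg_job s' = seg_job s" "j' \<in> set js'"
      "seg_job s = jid j'" "seg_start s' = max (seg_start s) a" "seg_end s' = min (seg_end s) b"
      "seg_speed s' = seg_work ss (seg_job s) / clip_time a b ss (seg_job s)" by blast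
    obtain j where j: "j \<in> set js" "jid j = jid j'" "release j' \<le> max (release j) a" "min (deadline j) b \<le> deadline j'"
      using js'[OF s(3)] by blast
    have "release j \<le> seg_start s \<and> seg_end s \<le> deadline j"
      using D(1)[OF _ s(1) j(1)] s j valid by (simp add: valid_instance_def)
    hence "release j' \<le> seg_start s' \<and> seg_end s' \<le> deadline j'"
      using s(5,6) j(3,4) by linarith
    thus "\<exists>j\<in>set js'. jid j = seg_job s' \<and> release j \<le> seg_start s' \<and> seg_end s' \<le> deadline j"
      using s by auto
    show "0 \<le> seg_speed s'"
      using s work_js'[OF s(3)] pos[OF s(3)] by simp
  next
    fix s1 s2 t
    assume *: "s1 \<in> set (clip a b js' ss)" "s2 \<in> set (clip a b js' ss)" "seg_job s1 = seg_job s2"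
      "running s1 (seg_proc s1) t" "running s2 (seg_proc s2) t"
    obtain s1' s2' where "s1' \<in> set ss" "s2' \<in> set ss" "seg_job s1' = seg_job s1" "seg_job s2' = seg_job s2"
      "seg_proc s1' = seg_proc s1" "seg_proc s2' = seg_proc s2"
      "seg_start s1' \<le> seg_start s1" "seg_start s2' \<le> seg_start s2"
      "seg_end s1 \<le> seg_end s1'" "seg_end s2 \<le> seg_end s2'"
      using mem[OF *(1)] mem[OF *(2)] by auto
    thus "seg_proc s1 = seg_proc s2" using D(3)[of s1' s2' t] * by simp
  next
    fix j assume j: "j \<in> set js'"
    have "seg_work (clip a b js' ss) (jid j) =
       (\<Sum>i\<leftarrow>js'. (if jid i = jid j then work i / clip_time a b ss (jid i) else 0) * clip_time a b ss (jid i))"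
      unfolding seg_work_def by (rule sum_clip)
    also have "\<dots> = (\<Sum>i\<leftarrow>js'. if jid j = jid i then work j else 0)"
    proof (intro arg_cong[of _ _ sum_list] map_cong refl)
      fix i assume i: "i \<in> set js'"
      have "i = j" if "jid i = jid j"
        using i j that dist by (auto simp: distinct_map dest: inj_onD)
      thus "(if jid i = jid j then work i / clip_time a b ss (jid i) else 0) * clip_time a b ss (jid i) =
        (if jid j = jid i then work j else 0)"
        using pos[OF i] by (cases "jid i = jid j") auto
    qed
    also have "\<dots> = work j" using j by (simp add: sum_list_indicator[OF dist])
    finally show "seg_work (clip a b js' ss) (jid j) = work j" .
  qed
qed

section \<open>Correctness and ratio of the clique algorithm\<close>

lemma seg_energy_append: "seg_energy \<alpha> (ss @ ss') = seg_energy \<alpha> ss + seg_energy \<alpha> ss'"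
  by (simp add: seg_energy_def)

lemma seg_energy_nonneg:
  assumes "wf_segments m ss"
  shows "0 \<le> seg_energy \<alpha> ss"
  unfolding seg_energy_def using wf_segmentsD(2)[OF assms]
  by (intro sum_list_nonneg) (force intro: mult_nonneg_nonneg less_imp_le)

lemma sum_list_partition:
  fixes f :: "_ \<Rightarrow> 'a :: comm_monoid_add"
  shows "(\<Sum>x\<leftarrow>filter P xs. f x) + (\<Sum>x\<leftarrow>filter (\<lambda>x. \<not> P x) xs. f x) = (\<Sum>x\<leftarrow>xs. f x)"
  by (induction xs) (auto simp: ac_simps)

lemma with_release_simps [simp]:
  "jid (with_release T j) = jid j" "work (with_release T j) = work j"
  "release (with_release T j) = T" "deadline (with_release T j) = deadline j"
  by (auto simp: with_release_def)

lemma with_deadline_simps [simp]: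
  "jid (with_deadline T j) = jid j" "work (with_deadline T j) = work j"
  "release (with_deadline T j) = release j" "deadline (with_deadline T j) = T"
  by (auto simp: with_deadline_def)

context
  fixes \<alpha> :: real and opt :: "nat \<Rightarrow> job list \<Rightarrow> segment list" and m :: nat
  assumes \<alpha>: "1 < \<alpha>" and m: "1 \<le> m"
    and opt: "\<And>js. valid_instance js \<Longrightarrow>
           wf_segments m (opt m js) \<and> optimal_preemptive \<alpha> m js (schedule_of (opt m js))"
begin

lemma opt_wf: "valid_instance js \<Longrightarrow> wf_segments m (opt m js)"
  using opt by blast

lemma opt_feasible: "valid_instance js \<Longrightarrow> preemptive_feasible m js (schedule_of (opt m js))"
  using opt by (simp add: optimal_preemptive_def)

lemma opt_energy_le:
  "valid_instance js \<Longrightarrow> preemptive_feasible m js S \<Longrightarrow> ennreal (seg_energy \<alpha> (opt m js)) \<le> energy \<alpha> m S"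
  using opt[of js] energy_schedule_of[of m "opt m js" \<alpha>] unfolding optimal_preemptive_def by metis

text \<open>Three comparisons are chained. Undoing the shortened processing times costs
  \<open>c powr (\<alpha> - 1)\<close>; by optimality, \<open>opt\<close> on \<open>js'\<close> uses
  no more energy than the clipped schedule; and clipping retains at least half of each execution
  time, which costs \<open>2 powr (\<alpha> - 1)\<close>. The last sum still refers to the schedule
  of \<open>js\<close>, so that the bounds for the two halves can be added.\<close>

lemma sum_cost_half_le:
  assumes valid: "valid_instance js" "valid_instance js'"
    and js': "\<And>j'. j' \<in> set js' \<Longrightarrow> \<exists>j\<in>set js. jid j = jid j' \<and> work j = work j' \<and>
       release j' \<le> max (release j) a \<and> min (deadline j) b \<le> deadline j'"
    and half: "\<And>j. j \<in> set js' \<Longrightarrow> exec_time (opt m js) (jid j) \<le> 2 * clip_time a b (opt m js) (jid j)"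
  shows "(\<Sum>j\<leftarrow>js'. cost \<alpha> (work j) (exec_time (opt m js') (jid j) / (2 - 1 / real m))) \<le>
         (2 * (2 - 1 / real m)) powr (\<alpha> - 1) * (\<Sum>j\<leftarrow>js'. cost \<alpha> (work j) (exec_time (opt m js) (jid j)))"
proof -
  define c where "c = 2 - 1 / real m"
  define S where "S = opt m js"
  have "1 / real m \<le> 1" using m by simp
  hence c: "0 < c" by (simp add: c_def)
  have work: "0 < work j" if "j \<in> set js'" for j using that valid(2) by (simp add: valid_instance_def)
  have e: "0 < exec_time S (jid j)" if "j \<in> set js'" for j
    using js'[OF that] feasible_exec_time_pos[OF opt_wf opt_feasible] valid(1) unfolding S_def by metis
  have e': "0 < exec_time (opt m js') (jid j)" if "j \<in> set js'" for j
    using feasible_exec_time_pos[OF opt_wf opt_feasible] valid(2) that by blast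
  have pos: "0 < clip_time a b S (jid j)" if "j \<in> set js'" for j
    using half[OF that] e[OF that] by (simp add: S_def)
  have dist: "distinct (map jid js')" using valid(2) by (simp add: valid_instance_def)
  note clip = clip_correct[OF opt_wf[OF valid(1)] opt_feasible[OF valid(1)] valid(1) dist js' pos[unfolded S_def]]
  have "(\<Sum>j\<leftarrow>js'. cost \<alpha> (work j) (exec_time (opt m js') (jid j) / c)) =
        c powr (\<alpha> - 1) * (\<Sum>j\<leftarrow>js'. cost \<alpha> (work j) (exec_time (opt m js') (jid j)))"
    unfolding sum_list_const_mult[symmetric]
    by (intro arg_cong[of _ _ sum_list] map_cong refl cost_divide c work e')
  also have "\<dots> \<le> c powr (\<alpha> - 1) * seg_energy \<alpha> (opt m js')"
    by (intro mult_left_mono sum_cost_le_seg_energy[OF \<alpha> opt_wf opt_feasible] valid(2)) auto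
  also have "ennreal (seg_energy \<alpha> (opt m js')) \<le> ennreal (seg_energy \<alpha> (clip a b js' S))"
    using opt_energy_le[OF valid(2) clip(2)] by (simp add: energy_schedule_of[OF clip(1)] S_def)
  hence "c powr (\<alpha> - 1) * seg_energy \<alpha> (opt m js') \<le> c powr (\<alpha> - 1) * seg_energy \<alpha> (clip a b js' S)"
    using seg_energy_nonneg[OF clip(1)] by (intro mult_left_mono) (auto simp: ennreal_le_iff S_def)
  also have "seg_energy \<alpha> (clip a b js' S) = (\<Sum>j\<leftarrow>js'. cost \<alpha> (work j) (clip_time a b S (jid j)))"
    unfolding S_def by (rule clip(3))
  also have "\<dots> \<le> (\<Sum>j\<leftarrow>js'. cost \<alpha> (work j) (exec_time S (jid j) / 2))"
    using \<alpha> work e half by (intro sum_list_mono cost_antimono) (force simp: S_def)+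
  also have "\<dots> = 2 powr (\<alpha> - 1) * (\<Sum>j\<leftarrow>js'. cost \<alpha> (work j) (exec_time S (jid j)))"
    unfolding sum_list_const_mult[symmetric]
    by (intro arg_cong[of _ _ sum_list] map_cong refl cost_divide work e) auto
  finally show ?thesis
    using c unfolding c_def[symmetric] S_def[symmetric]
    by (simp add: mult_left_mono powr_mult mult.assoc mult.left_commute)
qed

text \<open>The two schedules meet only at \<open>T\<close>, hence they do not conflict. Since the
  loss is bounded job by job against a single schedule of \<open>js\<close>, the sums over
  \<open>L\<close> and \<open>R\<close> recombine without a further factor. Validity of the two
  subinstances is stated as well because the running time bounds rely on it.\<close>

lemma cl_correct:
  assumes valid: "valid_instance js" and "js \<noteq> []"
    and clique: "\<And>j. j \<in> set js \<Longrightarrow> release j \<le> min_list (map deadline js)"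
  defines "T \<equiv> min_list (map deadline js)"
  defines "L \<equiv> filter (\<lambda>j. exec_before T (opt m js) (jid j) \<ge> exec_after T (opt m js) (jid j)) js"
    and "R \<equiv> filter (\<lambda>j. exec_before T (opt m js) (jid j) < exec_after T (opt m js) (jid j)) js"
  shows "valid_instance (map (with_deadline T) L)" "valid_instance (map (with_release T) R)"
    and "one_piece m js (cl opt m js)"
    and "seg_energy \<alpha> (cl opt m js) \<le> (2 * (2 - 1 / real m)) powr (\<alpha> - 1) * seg_energy \<alpha> (opt m js)"
proof -
  define S where "S = opt m js"
  define c where "c = 2 - 1 / real m"
  note wf = opt_wf[OF valid] and feas = opt_feasible[OF valid]
  note len = wf_segmentsD(2)[OF wf]
  have T_le: "T \<le> deadline j" if "j \<in> set js" for j
    using that \<open>js \<noteq> []\<close> by (simp add: T_def min_list_Min)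
  have R_def': "R = filter (\<lambda>j. \<not> exec_before T S (jid j) \<ge> exec_after T S (jid j)) js"
    unfolding R_def S_def by (simp add: not_le)
  \<comment> \<open>A finite list of pieces has a lower bound for its starts and an upper bound for
    its ends; these complete the half-lines before and after \<open>T\<close> to intervals.\<close>
  obtain a where a: "\<And>s. s \<in> set S \<Longrightarrow> a \<le> seg_start s"
    using bdd_below_finite[of "seg_start ` set S"] by (auto simp: bdd_below_def)
  obtain b where b: "\<And>s. s \<in> set S \<Longrightarrow> seg_end s \<le> b"
    using bdd_above_finite[of "seg_end ` set S"] by (auto simp: bdd_above_def)
  have bef: "exec_before T S k = clip_time a T S k" for k using a by (rule exec_before_eq_clip_time)
  have aft: "exec_after T S k = clip_time T b S k" for k using b by (rule exec_after_eq_clip_time)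
  have sum: "exec_time S k = clip_time a T S k + clip_time T b S k" for k
    using exec_time_eq_before_plus_after[of S k T] len bef aft by (simp add: S_def)
  have pos: "0 < exec_time S (jid j)" if "j \<in> set js" for j
    using feasible_exec_time_pos[OF wf feas valid that] by (simp add: S_def)
  have L: "j \<in> set js" "exec_time S (jid j) \<le> 2 * clip_time a T S (jid j)" if "j \<in> set L" for j
    using that sum[of "jid j"] by (auto simp: L_def bef aft simp flip: S_def)
  have R: "j \<in> set js" "exec_time S (jid j) \<le> 2 * clip_time T b S (jid j)" if "j \<in> set R" for j
    using that sum[of "jid j"] by (auto simp: R_def bef aft simp flip: S_def)
  have win: "release j \<le> seg_start s \<and> seg_end s \<le> deadline j"
    if "s \<in> set S" "seg_job s = jid j" "j \<in> set js" for s j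
    using preemptive_feasible_schedule_ofD(1)[OF wf feas, of s j] that valid
    by (simp add: S_def valid_instance_def)
  \<comment> \<open>A job of \<open>L\<close> has positive execution time before \<open>T\<close>,
    so its truncated window is nonempty. The symmetric fact for \<open>R\<close> follows in the same
    way.\<close>
  have rel: "release j < T" if "j \<in> set L" for j
  proof -
    have "0 < clip_time a T S (jid j)" using L[OF that] pos[of j] by simp
    then obtain s where s: "s \<in> set S" "seg_job s = jid j" "max (seg_start s) a < min (seg_end s) T"
      by (rule clip_time_posE)
    thus ?thesis using win[OF s(1,2)] L[OF that] by simp
  qed
  have ddl: "T < deadline j" if "j \<in> set R" for j
  proof -
    have "0 < clip_time T b S (jid j)" using R[OF that] pos[of j] by simp
    then obtain s where s: "s \<in> set S" "seg_job s = jid j" "max (seg_start s) T < min (seg_end s) b"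
      by (rule clip_time_posE)
    thus ?thesis using win[OF s(1,2)] R[OF that] by fastforce
  qed
  have dist: "distinct (map jid (map (with_deadline T) L))" "distinct (map jid (map (with_release T) R))"
    using valid by (auto simp: L_def R_def comp_def valid_instance_def intro: distinct_map_filter)
  show validL: "valid_instance (map (with_deadline T) L)"
    using dist(1) L(1) rel valid by (auto simp: valid_instance_def)
  show validR: "valid_instance (map (with_release T) R)"
    using dist(2) R(1) ddl valid by (auto simp: valid_instance_def)
  have cl: "cl opt m js = cd opt m T (map (with_deadline T) L) @ crd opt m T (map (with_release T) R)"
    by (simp add: cl_def Let_def L_def R_def T_def)
  note cd = cd_correct[where opt = opt, OF m validL opt_wf[OF validL] opt_feasible[OF validL], where D = T]
  note crd = crd_correct[where opt = opt, OF m validR opt_wf[OF validR] opt_feasible[OF validR], where R = T]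
  have "one_piece m (map (with_deadline T) L @ map (with_release T) R) (cl opt m js)"
    unfolding cl
  proof (rule one_piece_append)
    show L': "one_piece m (map (with_deadline T) L) (cd opt m T (map (with_deadline T) L))"
      by (rule cd(1)) auto
    show R': "one_piece m (map (with_release T) R) (crd opt m T (map (with_release T) R))"
      by (rule crd(1)) auto
    fix s s' assume "s \<in> set (cd opt m T (map (with_deadline T) L))" "s' \<in> set (crd opt m T (map (with_release T) R))"
    hence "seg_end s \<le> T" "T \<le> seg_start s'" using L' R' unfolding one_piece_def by fastforce+
    thus "seg_end s \<le> seg_start s' \<or> seg_end s' \<le> seg_start s" by simp
  qed
  \<comment> \<open>\<open>L\<close> and \<open>R\<close> are disjoint, so the two modifications can
    be combined into the single function that \<open>one_piece_widen\<close> takes.\<close>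
  moreover have "map (with_deadline T) L @ map (with_release T) R =
      map (\<lambda>j. if j \<in> set L then with_deadline T j else with_release T j) (L @ R)"
    by (auto simp: L_def R_def)
  ultimately have "one_piece m (map (\<lambda>j. if j \<in> set L then with_deadline T j else with_release T j) (L @ R)) (cl opt m js)"
    by simp
  \<comment> \<open>The modified windows lie inside the original ones: no deadline is before
    \<open>T\<close>, and in a clique no release date is after \<open>T\<close>.\<close>
  hence "one_piece m (L @ R) (cl opt m js)"
    by (rule one_piece_widen) (use L(1) R(1) T_le clique in \<open>auto simp: T_def\<close>)
  moreover have "mset (L @ R) = mset js"
    unfolding R_def' L_def S_def by (simp add: multiset_partition[symmetric])
  ultimately show "one_piece m js (cl opt m js)" by (rule one_piece_cong_mset)
  have "seg_energy \<alpha> (cd opt m T (map (with_deadline T) L)) =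
        (\<Sum>j\<leftarrow>map (with_deadline T) L. cost \<alpha> (work j) (exec_time (opt m (map (with_deadline T) L)) (jid j) / c))"
    unfolding c_def by (rule cd(2)) auto
  also have "\<dots> \<le> (2 * c) powr (\<alpha> - 1) * (\<Sum>j\<leftarrow>map (with_deadline T) L. cost \<alpha> (work j) (exec_time S (jid j)))"
    unfolding c_def S_def
  proof (rule sum_cost_half_le[OF valid validL])
    fix j' assume "j' \<in> set (map (with_deadline T) L)"
    then obtain j where j: "j' = with_deadline T j" "j \<in> set L" by auto
    show "exec_time (opt m js) (jid j') \<le> 2 * clip_time a T (opt m js) (jid j')"
      using L(2)[OF j(2)] j(1) by (simp add: S_def)
    show "\<exists>j\<in>set js. jid j = jid j' \<and> work j = work j' \<and>
       release j' \<le> max (release j) a \<and> min (deadline j) T \<le> deadline j'"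
      using L(1)[OF j(2)] j(1) by (intro bexI[of _ j]) auto
  qed
  finally have 1: "seg_energy \<alpha> (cd opt m T (map (with_deadline T) L)) \<le>
     (2 * c) powr (\<alpha> - 1) * (\<Sum>j\<leftarrow>L. cost \<alpha> (work j) (exec_time S (jid j)))" by (simp add: comp_def)
  have "seg_energy \<alpha> (crd opt m T (map (with_release T) R)) =
        (\<Sum>j\<leftarrow>map (with_release T) R. cost \<alpha> (work j) (exec_time (opt m (map (with_release T) R)) (jid j) / c))"
    unfolding c_def by (rule crd(2)) auto
  also have "\<dots> \<le> (2 * c) powr (\<alpha> - 1) * (\<Sum>j\<leftarrow>map (with_release T) R. cost \<alpha> (work j) (exec_time S (jid j)))"
    unfolding c_def S_def
  proof (rule sum_cost_half_le[OF valid validR])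
    fix j' assume "j' \<in> set (map (with_release T) R)"
    then obtain j where j: "j' = with_release T j" "j \<in> set R" by auto
    show "exec_time (opt m js) (jid j') \<le> 2 * clip_time T b (opt m js) (jid j')"
      using R(2)[OF j(2)] j(1) by (simp add: S_def)
    show "\<exists>j\<in>set js. jid j = jid j' \<and> work j = work j' \<and>
       release j' \<le> max (release j) T \<and> min (deadline j) b \<le> deadline j'"
      using R(1)[OF j(2)] j(1) by (intro bexI[of _ j]) auto
  qed
  finally have 2: "seg_energy \<alpha> (crd opt m T (map (with_release T) R)) \<le>
     (2 * c) powr (\<alpha> - 1) * (\<Sum>j\<leftarrow>R. cost \<alpha> (work j) (exec_time S (jid j)))" by (simp add: comp_def)
  have "seg_energy \<alpha> (cl opt m js) \<le> (2 * c) powr (\<alpha> - 1) *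
      ((\<Sum>j\<leftarrow>L. cost \<alpha> (work j) (exec_time S (jid j))) + (\<Sum>j\<leftarrow>R. cost \<alpha> (work j) (exec_time S (jid j))))"
    using 1 2 unfolding cl seg_energy_append by (simp add: distrib_left)
  also have "(\<Sum>j\<leftarrow>L. cost \<alpha> (work j) (exec_time S (jid j))) + (\<Sum>j\<leftarrow>R. cost \<alpha> (work j) (exec_time S (jid j))) =
      (\<Sum>j\<leftarrow>js. cost \<alpha> (work j) (exec_time S (jid j)))"
    unfolding L_def R_def' S_def by (rule sum_list_partition)
  also have "(2 * c) powr (\<alpha> - 1) * \<dots> \<le> (2 * c) powr (\<alpha> - 1) * seg_energy \<alpha> S"
    unfolding S_def by (intro mult_left_mono sum_cost_le_seg_energy[OF \<alpha> wf feas valid]) auto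
  finally show "seg_energy \<alpha> (cl opt m js) \<le> (2 * (2 - 1 / real m)) powr (\<alpha> - 1) * seg_energy \<alpha> (opt m js)"
    by (simp add: c_def S_def)
qed

end

section \<open>Agreeable instances\<close>

lemma nn_integral_compress:
  fixes f :: "real \<Rightarrow> ennreal"
  assumes [measurable]: "f \<in> borel_measurable borel"
  shows "(\<integral>\<^sup>+t. 2 * f (2 * t - T) \<partial>lborel) = (\<integral>\<^sup>+t. f t \<partial>lborel)"
proof -
  have "(\<integral>\<^sup>+t. 2 * f (2 * t - T) \<partial>lborel) = 2 * (\<integral>\<^sup>+t. f (- T + 2 * t) \<partial>lborel)"
    by (subst nn_integral_cmult) (auto simp: algebra_simps)
  also have "\<dots> = (\<integral>\<^sup>+t. f t \<partial>lborel)"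
    using nn_integral_real_affine[of f 2 "- T"] by simp
  finally show ?thesis .
qed

text \<open>The share of the energy spent on the jobs of \<open>K\<close>. It is additive over
  disjoint sets, which lets the parts of the partition be charged to one common schedule without
  counting any energy twice.\<close>

definition partial_energy :: "real \<Rightarrow> nat \<Rightarrow> schedule \<Rightarrow> nat set \<Rightarrow> ennreal" where
  "partial_energy \<alpha> m S K =
     (\<Sum>i<m. \<integral>\<^sup>+t\<in>{t. \<exists>k\<in>K. run S i t = Some k}. ennreal (speed S i t powr \<alpha>) \<partial>lborel)"

lemma sets_run_in:
  assumes "preemptive_feasible m js S" "i < m" "finite K"
  shows "{t. \<exists>k\<in>K. run S i t = Some k} \<in> sets borel"
proof -
  have "{t. \<exists>k\<in>K. run S i t = Some k} = (\<Union>k\<in>K. {t. run S i t = Some k})" by auto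
  also have "\<dots> \<in> sets borel"
    using assms unfolding preemptive_feasible_def by (intro sets.finite_UN) auto
  finally show ?thesis .
qed

lemma partial_energy_Un:
  assumes S: "preemptive_feasible m js S" and fin: "finite K" "finite K'" and disj: "K \<inter> K' = {}"
  shows "partial_energy \<alpha> m S (K \<union> K') = partial_energy \<alpha> m S K + partial_energy \<alpha> m S K'"
  unfolding partial_energy_def sum.distrib[symmetric]
proof (intro sum.cong refl)
  fix i assume "i \<in> {..<m}"
  hence i: "i < m" by simp
  note [measurable] = sets_run_in[OF S i fin(1)] sets_run_in[OF S i fin(2)]
  have [measurable]: "speed S i \<in> borel_measurable borel"
    using S i unfolding preemptive_feasible_def by blast
  have "(\<integral>\<^sup>+t\<in>{t. \<exists>k\<in>K \<union> K'. run S i t = Some k}. ennreal (speed S i t powr \<alpha>) \<partial>lborel) =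
    (\<integral>\<^sup>+t. ennreal (speed S i t powr \<alpha>) * indicator {t. \<exists>k\<in>K. run S i t = Some k} t +
          ennreal (speed S i t powr \<alpha>) * indicator {t. \<exists>k\<in>K'. run S i t = Some k} t \<partial>lborel)"
    using disj by (intro nn_integral_cong) (auto simp: indicator_def)
  also have "\<dots> = (\<integral>\<^sup>+t\<in>{t. \<exists>k\<in>K. run S i t = Some k}. ennreal (speed S i t powr \<alpha>) \<partial>lborel) +
      (\<integral>\<^sup>+t\<in>{t. \<exists>k\<in>K'. run S i t = Some k}. ennreal (speed S i t powr \<alpha>) \<partial>lborel)"
    by (intro nn_integral_add) measurable
  finally show "(\<integral>\<^sup>+t\<in>{t. \<exists>k\<in>K \<union> K'. run S i t = Some k}. ennreal (speed S i t powr \<alpha>) \<partial>lborel) =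
      (\<integral>\<^sup>+t\<in>{t. \<exists>k\<in>K. run S i t = Some k}. ennreal (speed S i t powr \<alpha>) \<partial>lborel) +
      (\<integral>\<^sup>+t\<in>{t. \<exists>k\<in>K'. run S i t = Some k}. ennreal (speed S i t powr \<alpha>) \<partial>lborel)" .
qed

lemma partial_energy_le_energy: "partial_energy \<alpha> m S K \<le> energy \<alpha> m S"
  unfolding partial_energy_def energy_def
  by (intro sum_mono nn_integral_mono) (auto simp: indicator_def)

text \<open>Contraction by the factor 2 towards time \<open>T\<close>, which turns the window of \<open>j\<close> into that of
  \<open>halve T j\<close>.\<close>

definition compress :: "real \<Rightarrow> nat set \<Rightarrow> schedule \<Rightarrow> schedule" where
  "compress T K S =
     \<lparr>run = (\<lambda>i t. if \<exists>k\<in>K. run S i (2 * t - T) = Some k then run S i (2 * t - T) else None),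
      speed = (\<lambda>i t. if \<exists>k\<in>K. run S i (2 * t - T) = Some k then 2 * speed S i (2 * t - T) else 0)\<rparr>"

lemma halve_simps [simp]:
  "jid (halve T j) = jid j" "work (halve T j) = work j"
  "release (halve T j) = (release j + T) / 2" "deadline (halve T j) = (deadline j + T) / 2"
  by (auto simp: halve_def field_simps)

lemma run_compress:
  "run (compress T K S) i t = Some k \<longleftrightarrow> k \<in> K \<and> run S i (2 * t - T) = Some k"
  by (auto simp: compress_def)

text \<open>A time \<open>t\<close> lies in the halved window exactly when \<open>2 * t - T\<close>
  lies in the original one. Half the duration at twice the speed preserves the work, by the change
  of variables in \<open>nn_integral_compress\<close>. Jobs outside \<open>jl\<close> are
  erased.\<close>

lemma compress_feasible:
  assumes S: "preemptive_feasible m js S" and valid: "valid_instance js" and sub: "set jl \<subseteq> set js"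
  shows "preemptive_feasible m (map (halve T) jl) (compress T (jid ` set jl) S)"
proof -
  let ?K = "jid ` set jl"
  have meas: "speed S i \<in> borel_measurable borel" "{t. run S i t = Some k} \<in> sets borel" if "i < m" for i k
    using S that unfolding preemptive_feasible_def by blast+
  have nonneg: "0 \<le> speed S i t" if "i < m" for i t
    using S that unfolding preemptive_feasible_def by blast
  have window: "\<exists>j\<in>set js. jid j = k \<and> release j \<le> t \<and> t \<le> deadline j"
    if "i < m" "run S i t = Some k" for i t k
    using S that unfolding preemptive_feasible_def by blast
  have unique: "i = i'" if "i < m" "i' < m" "run S i t = Some k" "run S i' t = Some k" for i i' t k
    using S that unfolding preemptive_feasible_def by blast
  have works: "work_done m S (jid j) = ennreal (work j)" if "j \<in> set js" for j
    using S that unfolding preemptive_feasible_def by blast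
  have inj: "j = j'" if "j \<in> set js" "j' \<in> set js" "jid j = jid j'" for j j'
    using valid that by (auto simp: valid_instance_def distinct_map dest: inj_onD)
  show ?thesis
    unfolding preemptive_feasible_def
  proof (intro conjI allI impI ballI)
    fix i assume i: "i < m"
    note [measurable] = meas[OF i] sets_run_in[OF S i, of ?K, simplified]
    have "(\<lambda>t. 2 * t - T) -` {t. \<exists>k\<in>?K. run S i t = Some k} \<inter> space borel \<in> sets borel"
      by (intro measurable_sets[of _ borel borel] sets_run_in[OF S i]) auto
    hence A: "{t. \<exists>k\<in>?K. run S i (2 * t - T) = Some k} \<in> sets borel" by simp
    have [measurable]: "(\<lambda>t. \<exists>k\<in>?K. run S i (2 * t - T) = Some k) \<in> measurable borel (count_space UNIV)"
      using A by (simp add: pred_def)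
    show "speed (compress T ?K S) i \<in> borel_measurable borel"
      unfolding compress_def schedule.simps by measurable
    fix k
    have "(\<lambda>t. 2 * t - T) -` {t. run S i t = Some k} \<inter> space borel \<in> sets borel"
      by (intro measurable_sets[of _ borel borel] meas i) auto
    hence "{t. run S i (2 * t - T) = Some k} \<in> sets borel" by simp
    moreover have "{t. run (compress T ?K S) i t = Some k} =
        (if k \<in> ?K then {t. run S i (2 * t - T) = Some k} else {})"
      by (auto simp: run_compress)
    ultimately show "{t. run (compress T ?K S) i t = Some k} \<in> sets borel" by simp
  next
    fix i t assume i: "i < m"
    show "0 \<le> speed (compress T ?K S) i t"
      using nonneg[OF i] by (simp add: compress_def)
    assume "run (compress T ?K S) i t = None"
    thus "speed (compress T ?K S) i t = 0"
      by (auto simp: compress_def split: if_splits)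
  next
    fix i t k assume "i < m" "run (compress T ?K S) i t = Some k"
    then obtain j where j: "k = jid j" "j \<in> set jl" "run S i (2 * t - T) = Some k"
      by (auto simp: run_compress)
    obtain j' where "j' \<in> set js" "jid j' = k" "release j' \<le> 2 * t - T" "2 * t - T \<le> deadline j'"
      using window[OF \<open>i < m\<close> j(3)] by blast
    moreover from this have "j' = j" using inj[of j' j] j sub by blast
    ultimately show "\<exists>j\<in>set (map (halve T) jl). jid j = k \<and> release j \<le> t \<and> t \<le> deadline j"
      using j(2) by (auto simp: field_simps)
  next
    fix i i' t k assume "i < m" "i' < m"
      "run (compress T ?K S) i t = Some k \<and> run (compress T ?K S) i' t = Some k"
    thus "i = i'" using unique[of i i' "2 * t - T" k] by (simp add: run_compress)
  next
    fix j' assume "j' \<in> set (map (halve T) jl)"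
    then obtain j where j: "j \<in> set jl" "j' = halve T j" by auto
    have "work_done m (compress T ?K S) (jid j) = work_done m S (jid j)"
      unfolding work_done_def
    proof (intro sum.cong refl)
      fix i assume "i \<in> {..<m}"
      hence i: "i < m" by simp
      note [measurable] = meas[OF i]
      have "(\<integral>\<^sup>+t\<in>{t. run (compress T ?K S) i t = Some (jid j)}. ennreal (speed (compress T ?K S) i t) \<partial>lborel) =
        (\<integral>\<^sup>+t. 2 * (ennreal (speed S i (2 * t - T)) * indicator {t. run S i t = Some (jid j)} (2 * t - T)) \<partial>lborel)"
        using j(1) nonneg[OF i]
        by (intro nn_integral_cong) (auto simp: run_compress compress_def indicator_def ennreal_mult)
      also have "\<dots> = (\<integral>\<^sup>+t\<in>{t. run S i t = Some (jid j)}. ennreal (speed S i t) \<partial>lborel)"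
        by (rule nn_integral_compress) measurable
      finally show "(\<integral>\<^sup>+t\<in>{t. run (compress T ?K S) i t = Some (jid j)}. ennreal (speed (compress T ?K S) i t) \<partial>lborel) =
        (\<integral>\<^sup>+t\<in>{t. run S i t = Some (jid j)}. ennreal (speed S i t) \<partial>lborel)" .
    qed
    thus "work_done m (compress T ?K S) (jid j') = ennreal (work j')"
      using works[of j] j sub by auto
  qed
qed

text \<open>Doubling the speed multiplies the power by \<open>2 powr \<alpha>\<close>, and the
  duration is halved.\<close>

lemma energy_compress:
  assumes S: "preemptive_feasible m js S" and "finite K" and \<alpha>: "1 < \<alpha>"
  shows "energy \<alpha> m (compress T K S) = ennreal (2 powr (\<alpha> - 1)) * partial_energy \<alpha> m S K"
  unfolding energy_def partial_energy_def sum_distrib_left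
proof (intro sum.cong refl)
  fix i assume "i \<in> {..<m}"
  hence i: "i < m" by simp
  note [measurable] = sets_run_in[OF S i \<open>finite K\<close>]
  have [measurable]: "speed S i \<in> borel_measurable borel"
    using S i unfolding preemptive_feasible_def by blast
  have nonneg: "0 \<le> speed S i t" for t using S i unfolding preemptive_feasible_def by blast
  let ?f = "\<lambda>t. ennreal (2 powr (\<alpha> - 1)) * (ennreal (speed S i t powr \<alpha>) * indicator {t. \<exists>k\<in>K. run S i t = Some k} t)"
  have *: "ennreal ((2 * x) powr \<alpha>) = 2 * (ennreal (2 powr (\<alpha> - 1)) * ennreal (x powr \<alpha>))" if "0 \<le> x" for x
  proof -
    have "(2 * x) powr \<alpha> = 2 * (2 powr (\<alpha> - 1) * x powr \<alpha>)"
      using that by (simp add: powr_mult powr_diff)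
    thus ?thesis by (simp add: ennreal_mult)
  qed
  have "(\<integral>\<^sup>+t. ennreal (speed (compress T K S) i t powr \<alpha>) \<partial>lborel) = (\<integral>\<^sup>+t. 2 * ?f (2 * t - T) \<partial>lborel)"
    using nonneg by (intro nn_integral_cong) (auto simp: compress_def indicator_def *)
  also have "\<dots> = (\<integral>\<^sup>+t. ?f t \<partial>lborel)"
    by (rule nn_integral_compress) measurable
  also have "\<dots> = ennreal (2 powr (\<alpha> - 1)) *
      (\<integral>\<^sup>+t\<in>{t. \<exists>k\<in>K. run S i t = Some k}. ennreal (speed S i t powr \<alpha>) \<partial>lborel)"
    by (rule nn_integral_cmult) measurable
  finally show "(\<integral>\<^sup>+t. ennreal (speed (compress T K S) i t powr \<alpha>) \<partial>lborel) = \<dots>" .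
qed

section \<open>One step of the partition\<close>

lemma valid_instance_filter:
  assumes "valid_instance js" shows "valid_instance (filter P js)"
  using assms by (auto simp: valid_instance_def intro: distinct_map_filter)

lemma valid_instance_halve:
  assumes "valid_instance js"
  shows "valid_instance (map (halve T) js)"
  using assms by (auto simp: valid_instance_def comp_def)

context
  fixes js :: "job list" and T :: real and part rest :: "job list"
  assumes valid: "valid_instance js" and ne: "js \<noteq> []"
  defines "T \<equiv> min_list (map deadline js)"
  defines "part \<equiv> filter (\<lambda>x. release x \<le> T) js" and "rest \<equiv> filter (\<lambda>x. T < release x) js"
begin

lemma T_le_deadline: "j \<in> set js \<Longrightarrow> T \<le> deadline j"
  using ne by (simp add: T_def min_list_Min)

text \<open>A job with the smallest deadline is released before it, so it belongs to the first part.
  This makes the recursion progress and puts a deadline of exactly \<open>T\<close> into the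
  part.\<close>

lemma first_job: obtains j where "j \<in> set part" "deadline j = T"
proof -
  have "T \<in> deadline ` set js"
    using ne Min_in[of "deadline ` set js"] by (simp add: T_def min_list_Min)
  then obtain j where "j \<in> set js" "deadline j = T" by auto
  moreover from this have "release j \<le> T" using valid by (auto simp: valid_instance_def intro: less_imp_le)
  ultimately show ?thesis using that by (simp add: part_def)
qed

lemma rest_shorter: "length rest < length js"
proof -
  obtain j where "j \<in> set part" by (rule first_job)
  hence "j \<in> set js" "\<not> T < release j" by (auto simp: part_def)
  thus ?thesis unfolding rest_def by (rule length_filter_less)
qed

lemma parts_rec: "parts js = (T, part) # parts rest"
proof (cases js)
  case (Cons j js')
  thus ?thesis using rest_shorter[unfolded rest_def T_def] by (simp add: T_def part_def rest_def Let_def)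
qed (use ne in simp)

lemma agr_rec: "agr opt m js = cl opt m (map (halve T) part) @ agr opt m rest"
  by (simp add: agr_def parts_rec)

lemma mset_part_rest: "mset (part @ rest) = mset js"
proof -
  have "rest = filter (\<lambda>x. \<not> release x \<le> T) js" by (simp add: rest_def not_le)
  thus ?thesis unfolding part_def by (simp add: multiset_partition[symmetric])
qed

text \<open>Halving moves both ends of a window towards \<open>T\<close>, so release dates stay at
  most \<open>T\<close> and deadlines at least \<open>T\<close>, while the job with deadline
  \<open>T\<close> keeps it. The halved part is therefore a clique whose smallest deadline is still
  \<open>T\<close>.\<close>

lemma halve_part:
  shows "valid_instance (map (halve T) part)" "map (halve T) part \<noteq> []"
    "min_list (map deadline (map (halve T) part)) = T"
    "\<And>j. j \<in> set (map (halve T) part) \<Longrightarrow> release j \<le> T"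
proof -
  obtain j where j: "j \<in> set part" "deadline j = T" by (rule first_job)
  show "valid_instance (map (halve T) part)"
    unfolding part_def by (intro valid_instance_halve valid_instance_filter valid)
  show ne': "map (halve T) part \<noteq> []" using j by auto
  have "Min (set (map deadline (map (halve T) part))) = T"
  proof (rule Min_eqI)
    show "T \<in> set (map deadline (map (halve T) part))" using j by force
    fix x assume "x \<in> set (map deadline (map (halve T) part))"
    thus "T \<le> x" using T_le_deadline by (auto simp: part_def)
  qed simp
  thus "min_list (map deadline (map (halve T) part)) = T"
    using ne' by (subst min_list_Min) auto
  show "release j \<le> T" if "j \<in> set (map (halve T) part)" for j
    using that by (auto simp: part_def)
qed

end

section \<open>Feasibility and energy of the combined schedule\<close>

context
  fixes \<alpha> :: real and opt :: "nat \<Rightarrow> job list \<Rightarrow> segment list" and m :: nat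
  assumes \<alpha>: "1 < \<alpha>" and m: "1 \<le> m"
    and opt: "\<And>js. valid_instance js \<Longrightarrow>
           wf_segments m (opt m js) \<and> optimal_preemptive \<alpha> m js (schedule_of (opt m js))"
begin

text \<open>The second conjunct strengthens the induction: a piece of a later part begins no earlier
  than the midpoint between some remaining release date and some remaining deadline. This suffices
  to separate it from the current part and avoids speaking about the later values of
  \<open>T\<close>.\<close>

lemma agr_one_piece:
  assumes "valid_instance js" "agreeable js"
  shows "one_piece m js (agr opt m js) \<and>
    (\<forall>s\<in>set (agr opt m js). \<exists>j\<in>set js. \<exists>j'\<in>set js. (release j + deadline j') / 2 \<le> seg_start s)"
  using assms
proof (induction "length js" arbitrary: js rule: less_induct)
  case less
  show ?case
  proof (cases "js = []")
    case True
    thus ?thesis by (simp add: agr_def)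
  next
    case False
    note valid = less.prems(1)
    define T where "T = min_list (map deadline js)"
    define part where "part = filter (\<lambda>x. release x \<le> T) js"
    define rest where "rest = filter (\<lambda>x. T < release x) js"
    note hp = halve_part[OF valid False, folded T_def, folded part_def rest_def]
    have cl: "one_piece m (map (halve T) part) (cl opt m (map (halve T) part))"
      by (rule cl_correct(3)[where opt = opt, OF \<alpha> m opt hp(1,2)]) (use hp(3,4) in auto)
    have valid': "valid_instance rest" unfolding rest_def by (rule valid_instance_filter[OF valid])
    have agr': "agreeable rest" using less.prems(2) by (auto simp: agreeable_def rest_def)
    have IH: "one_piece m rest (agr opt m rest)"
      "\<And>s. s \<in> set (agr opt m rest) \<Longrightarrow> \<exists>j\<in>set rest. \<exists>j'\<in>set rest. (release j + deadline j') / 2 \<le> seg_start s"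
      using less.hyps[OF rest_shorter[OF valid False, folded T_def, folded part_def rest_def] valid' agr'] by auto
    have part: "j \<in> set js" "release j \<le> T" "T \<le> deadline j" if "j \<in> set part" for j
      using that T_le_deadline[OF valid False, folded T_def, folded part_def rest_def] by (auto simp: part_def)
    have rest: "j \<in> set js" "T < release j" if "j \<in> set rest" for j
      using that by (auto simp: rest_def)
    have window: "\<exists>j\<in>set part. (release j + T) / 2 \<le> seg_start s \<and> seg_end s \<le> (deadline j + T) / 2"
      if "s \<in> set (cl opt m (map (halve T) part))" for s
      using cl that unfolding one_piece_def by fastforce
    have "one_piece m part (cl opt m (map (halve T) part))"
      using cl by (rule one_piece_widen) (use part in auto)
    hence "one_piece m (part @ rest) (agr opt m js)"
      unfolding agr_rec[OF valid False, folded T_def, folded part_def rest_def] using IH(1)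
    proof (rule one_piece_append)
      fix s s' assume s: "s \<in> set (cl opt m (map (halve T) part))" "s' \<in> set (agr opt m rest)"
      obtain j where j: "j \<in> set part" "seg_end s \<le> (deadline j + T) / 2" using window[OF s(1)] by blast
      obtain j1 j2 where j12: "j1 \<in> set rest" "j2 \<in> set rest" "(release j1 + deadline j2) / 2 \<le> seg_start s'"
        using IH(2)[OF s(2)] by blast
      \<comment> \<open>Agreeability yields \<open>deadline j \<le> deadline j2\<close>, and
        \<open>j1\<close> is released after \<open>T\<close>; hence
        \<open>(deadline j + T) / 2\<close> is at most
        \<open>(release j1 + deadline j2) / 2\<close>, even when \<open>j1\<close> and
        \<open>j2\<close> differ.\<close>
      have "release j \<le> release j2" using part(2)[OF j(1)] rest(2)[OF j12(2)] by simp
      hence "deadline j \<le> deadline j2"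
        using less.prems(2) part(1)[OF j(1)] rest(1)[OF j12(2)] unfolding agreeable_def by blast
      hence "seg_end s \<le> seg_start s'" using j(2) j12(3) rest(2)[OF j12(1)] by argo
      thus "seg_end s \<le> seg_start s' \<or> seg_end s' \<le> seg_start s" ..
    qed
    hence "one_piece m js (agr opt m js)"
      by (rule one_piece_cong_mset) (rule mset_part_rest[OF valid False, folded T_def, folded part_def rest_def])
    moreover have "\<exists>j\<in>set js. \<exists>j'\<in>set js. (release j + deadline j') / 2 \<le> seg_start s"
      if "s \<in> set (agr opt m js)" for s
    proof -
      consider "s \<in> set (cl opt m (map (halve T) part))" | "s \<in> set (agr opt m rest)"
        using \<open>s \<in> set (agr opt m js)\<close> unfolding agr_rec[OF valid False, folded T_def, folded part_def rest_def] by auto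
      thus ?thesis
      proof cases
        case 1
        \<comment> \<open>\<open>T\<close> is itself a deadline, so the lower end of a halved window
          has the form required by the invariant.\<close>
        obtain j' where "j' \<in> set part" "deadline j' = T" by (rule first_job[OF valid False, folded T_def, folded part_def rest_def])
        thus ?thesis using window[OF 1] part(1) by blast
      next
        case 2
        thus ?thesis using IH(2)[OF 2] rest(1) by blast
      qed
    qed
    ultimately show ?thesis by blast
  qed
qed

text \<open>The schedule \<open>S\<close> stays fixed for the full instance
  \<open>js\<^sub>0\<close> while the induction removes parts, because \<open>S\<close> also runs
  jobs outside the remaining list. Each part is charged only to the energy that \<open>S\<close>
  spends on its own jobs.\<close>

lemma agr_energy:
  assumes S: "preemptive_feasible m js\<^sub>0 S" and valid0: "valid_instance js\<^sub>0"
    and "valid_instance js" "set js \<subseteq> set js\<^sub>0"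
  shows "ennreal (seg_energy \<alpha> (agr opt m js)) \<le>
    ennreal ((4 * (2 - 1 / real m)) powr (\<alpha> - 1)) * partial_energy \<alpha> m S (jid ` set js)"
  using assms(3,4)
proof (induction "length js" arbitrary: js rule: less_induct)
  case less
  show ?case
  proof (cases "js = []")
    case True
    thus ?thesis by (simp add: agr_def seg_energy_def)
  next
    case False
    note valid = less.prems(1)
    define T where "T = min_list (map deadline js)"
    define part where "part = filter (\<lambda>x. release x \<le> T) js"
    define rest where "rest = filter (\<lambda>x. T < release x) js"
    note hp = halve_part[OF valid False, folded T_def, folded part_def rest_def]
    define c where "c = 2 - 1 / real m"
    have "1 / real m \<le> 1" using m by simp
    hence c: "0 \<le> c" by (simp add: c_def)
    have valid': "valid_instance rest" unfolding rest_def by (rule valid_instance_filter[OF valid])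
    have sub: "set part \<subseteq> set js\<^sub>0" "set rest \<subseteq> set js\<^sub>0" using less.prems(2) by (auto simp: part_def rest_def)
    have IH: "ennreal (seg_energy \<alpha> (agr opt m rest)) \<le>
        ennreal ((4 * c) powr (\<alpha> - 1)) * partial_energy \<alpha> m S (jid ` set rest)"
      unfolding c_def by (rule less.hyps[OF rest_shorter[OF valid False, folded T_def, folded part_def rest_def] valid' sub(2)])
    have "seg_energy \<alpha> (cl opt m (map (halve T) part)) \<le>
        (2 * c) powr (\<alpha> - 1) * seg_energy \<alpha> (opt m (map (halve T) part))"
      unfolding c_def by (rule cl_correct(4)[where opt = opt, OF \<alpha> m opt hp(1,2)]) (use hp(3,4) in auto)
    hence "ennreal (seg_energy \<alpha> (cl opt m (map (halve T) part))) \<le>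
        ennreal ((2 * c) powr (\<alpha> - 1) * seg_energy \<alpha> (opt m (map (halve T) part)))"
      by (rule ennreal_leI)
    also have "\<dots> = ennreal ((2 * c) powr (\<alpha> - 1)) * ennreal (seg_energy \<alpha> (opt m (map (halve T) part)))"
      using seg_energy_nonneg[OF opt_wf[where opt = opt, OF \<alpha> m opt hp(1)]] by (simp add: ennreal_mult)
    \<comment> \<open>The compressed restriction of \<open>S\<close> competes with the preemptive
      optimum of the halved part.\<close>
    also have "\<dots> \<le> ennreal ((2 * c) powr (\<alpha> - 1)) * energy \<alpha> m (compress T (jid ` set part) S)"
      by (intro mult_left_mono opt_energy_le[where opt = opt, OF \<alpha> m opt hp(1)] compress_feasible[OF S valid0 sub(1)]) auto
    also have "\<dots> = ennreal ((2 * c) powr (\<alpha> - 1)) * ennreal (2 powr (\<alpha> - 1)) *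
        partial_energy \<alpha> m S (jid ` set part)"
      using \<alpha> by (simp add: energy_compress[OF S] mult.assoc)
    also have "ennreal ((2 * c) powr (\<alpha> - 1)) * ennreal (2 powr (\<alpha> - 1)) = ennreal ((4 * c) powr (\<alpha> - 1))"
      using c powr_mult[of "2 * c" 2 "\<alpha> - 1"] by (simp add: ennreal_mult[symmetric])
    finally have part: "ennreal (seg_energy \<alpha> (cl opt m (map (halve T) part))) \<le>
        ennreal ((4 * c) powr (\<alpha> - 1)) * partial_energy \<alpha> m S (jid ` set part)" .
    have wf: "wf_segments m (cl opt m (map (halve T) part))"
      using cl_correct(3)[where opt = opt, OF \<alpha> m opt hp(1,2)] hp(3,4) unfolding one_piece_def by auto
    have un: "jid ` set js = jid ` set part \<union> jid ` set rest"
      using mset_eq_setD[OF mset_part_rest[OF valid False, folded T_def, folded part_def rest_def]] by auto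
    have disj: "jid ` set part \<inter> jid ` set rest = {}"
    proof -
      have inj: "inj_on jid (set js)" using valid by (simp add: valid_instance_def distinct_map)
      have "set part \<subseteq> set js" "set rest \<subseteq> set js" "set part \<inter> set rest = {}"
        by (auto simp: part_def rest_def)
      thus ?thesis using inj by (metis image_empty inj_on_image_Int)
    qed
    have "ennreal (seg_energy \<alpha> (agr opt m js)) \<le>
       ennreal (seg_energy \<alpha> (cl opt m (map (halve T) part))) + ennreal (seg_energy \<alpha> (agr opt m rest))"
      unfolding agr_rec[OF valid False, folded T_def, folded part_def rest_def] seg_energy_append
      using seg_energy_nonneg[OF wf]
      \<comment> \<open>If the second energy were negative, \<open>ennreal\<close> would map it to 0
        and the inequality would persist.\<close>
      by (cases "0 \<le> seg_energy \<alpha> (agr opt m rest)") (auto simp: ennreal_neg intro!: ennreal_leI)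
    also have "\<dots> \<le> ennreal ((4 * c) powr (\<alpha> - 1)) * partial_energy \<alpha> m S (jid ` set part) +
        ennreal ((4 * c) powr (\<alpha> - 1)) * partial_energy \<alpha> m S (jid ` set rest)"
      by (intro add_mono part IH)
    also have "\<dots> = ennreal ((4 * c) powr (\<alpha> - 1)) * partial_energy \<alpha> m S (jid ` set js)"
      unfolding un by (subst partial_energy_Un[OF S _ _ disj]) (auto simp: distrib_left)
    finally show ?thesis unfolding c_def .
  qed
qed

end

section \<open>Running time\<close>

text \<open>Coefficients in \<open>nat\<close> are nonnegative, so evaluation is monotone.\<close>

lemma poly_mono_nat: "x \<le> y \<Longrightarrow> poly p x \<le> poly p y" for p :: "nat poly"
  by (induction p) (auto intro: mult_mono)

lemma T_sum_list: "T_sum_list xs = length xs + 1"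
  by (induction xs) auto

lemma T_min_list: "T_min_list xs = length xs + 1"
  by (induction xs) auto

lemma T_arg_min_list: "T_arg_min_list xs = length xs + 1"
  by (induction xs) auto

lemma T_map_const: "T_map (\<lambda>_. c) xs = length xs * (c + 1) + 1"
  by (simp add: T_map sum_list_triv)

lemma T_filter_const: "T_filter (\<lambda>_. c) xs = length xs * (c + 1) + 1"
  by (simp add: T_filter sum_list_triv)

lemma T_insort_key_le: "T_insort_key f x xs \<le> length xs + 1"
  by (induction xs) auto

lemma T_sort_key_le: "T_sort_key f xs \<le> (length xs + 1)\<^sup>2"
proof (induction xs)
  case (Cons x xs)
  thus ?case using T_insort_key_le[of f x "sort_key f xs"] by (simp add: power2_eq_square)
qed simp

lemma T_concat: "T_concat xss = length (concat xss) + 2 * length xss + 1"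
  by (induction xss) (auto simp: T_append)

lemma T_exec: "T_exec ss = 3 * length ss + 2"
  by (simp add: T_exec_def T_map_const T_sum_list)

text \<open>The state never changes its length, so every placement costs the same: the search, the
  update and one step for the call.\<close>

lemma T_forward: "T_forward jps ps = length jps * (3 * length ps + 3) + 1"
  by (induction jps ps rule: T_forward.induct)
     (auto simp: Let_def T_arg_min_list T_set_free_def T_map_const split: prod.splits)

lemma T_backward: "T_backward jps ps = length jps * (3 * length ps + 3) + 1"
  by (induction jps ps rule: T_backward.induct)
     (auto simp: Let_def T_arg_min_list T_set_free_def T_map_const split: prod.splits)

lemma T_init_procs_le: "T_init_procs m js \<le> 4 * length js + 3"
  by (simp add: T_init_procs_def T_length T_upt_def T_map_const)

lemma length_init_procs_le: "length (init_procs m t js) \<le> length js"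
  by (simp add: init_procs_def)

text \<open>The bounds are polymorphic so that, applied to polynomials \<open>q\<close> and \<open>n\<close> instead of numbers, they
  yield the polynomial required for \<open>polynomial_time\<close>.\<close>

definition list_bound :: "'a :: comm_semiring_1 \<Rightarrow> 'a \<Rightarrow> 'a" where
  "list_bound q n = q + (n * (3 * q + 2 + 1) + 1) + (n + 1) ^ 2 + (4 * n + 3) + (n * (3 * n + 3) + 1)"

definition cl_bound :: "'a :: comm_semiring_1 \<Rightarrow> 'a \<Rightarrow> 'a" where
  "cl_bound q n = q + (n * 2 + 1) + (n + 1) + 2 * (n * (2 * (3 * q + 2) + 1) + 1) + 2 * (n * 2 + 1) +
     2 * list_bound q n + (n + 1)"

definition agr_bound :: "'a :: comm_semiring_1 \<Rightarrow> 'a \<Rightarrow> 'a" where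
  "agr_bound q n = 10 * (n + 1) ^ 2 + (n * (n * 2 + 1 + cl_bound q n) + n + 1) + (n + 2 * n + 1)"

lemma poly_agr_bound: "poly (agr_bound p n) x = agr_bound (poly p x) (poly n x)"
  by (simp add: agr_bound_def cl_bound_def list_bound_def)

section \<open>Polynomial bounds for the algorithms\<close>

lemma T_proc_times_le:
  assumes "T_opt m js \<le> q" "length (opt m js) \<le> q" "length js \<le> n"
  shows "T_proc_times opt T_opt m js \<le> q + (n * (3 * q + 2 + 1) + 1)"
  unfolding T_proc_times_def T_map_const T_exec
  using assms by (intro add_mono mult_mono) auto

lemma T_crd_le:
  assumes "T_opt m js \<le> q" "length (opt m js) \<le> q" "length js \<le> n"
  shows "T_crd opt T_opt m R js \<le> list_bound q n"
  unfolding T_crd_def Let_def list_bound_def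
proof (intro add_mono T_proc_times_le assms)
  show "T_sort_key (\<lambda>q. deadline (fst q)) (proc_times opt m js) \<le> (n + 1)\<^sup>2"
    by (rule order.trans[OF T_sort_key_le]) (use assms(3) in \<open>auto intro!: power_mono\<close>)
  show "T_init_procs m js \<le> 4 * n + 3"
    by (rule order.trans[OF T_init_procs_le]) (use assms(3) in simp)
  show "T_forward (sort_key (\<lambda>q. deadline (fst q)) (proc_times opt m js)) (init_procs m R js) \<le>
      n * (3 * n + 3) + 1"
    unfolding T_forward using assms(3) length_init_procs_le[of m R js]
    by (intro add_mono mult_mono) auto
qed

lemma T_cd_le:
  assumes "T_opt m js \<le> q" "length (opt m js) \<le> q" "length js \<le> n"
  shows "T_cd opt T_opt m D js \<le> list_bound q n"
  unfolding T_cd_def Let_def list_bound_def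
proof (intro add_mono T_proc_times_le assms)
  show "T_sort_key (\<lambda>q. - release (fst q)) (proc_times opt m js) \<le> (n + 1)\<^sup>2"
    by (rule order.trans[OF T_sort_key_le]) (use assms(3) in \<open>auto intro!: power_mono\<close>)
  show "T_init_procs m js \<le> 4 * n + 3"
    by (rule order.trans[OF T_init_procs_le]) (use assms(3) in simp)
  show "T_backward (sort_key (\<lambda>q. - release (fst q)) (proc_times opt m js)) (init_procs m D js) \<le>
      n * (3 * n + 3) + 1"
    unfolding T_backward using assms(3) length_init_procs_le[of m D js]
    by (intro add_mono mult_mono) auto
qed

text \<open>One level on \<open>n\<close> jobs costs at most \<open>9 * n + 7\<close> steps, and the
  recursive call at most \<open>10 * n\<^sup>2\<close> because the remaining list is strictly
  shorter. The increment \<open>20 * n + 10\<close> of the quadratic bound absorbs the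
  level.\<close>

lemma T_parts_le: "T_parts js \<le> 10 * (length js + 1)\<^sup>2"
proof (induction js rule: T_parts.induct)
  case (2 j js)
  define rest where "rest = filter (\<lambda>x. min_list (map deadline (j # js)) < release x) (j # js)"
  define n where "n = length (j # js)"
  have "(if length rest < n then T_parts rest else 0) \<le> 10 * n\<^sup>2"
  proof (cases "length rest < n")
    case True
    have "T_parts rest \<le> 10 * (length rest + 1)\<^sup>2"
      unfolding rest_def by (rule "2.IH"[OF refl refl]) (use True in \<open>simp_all add: rest_def n_def\<close>)
    also have "\<dots> \<le> 10 * n\<^sup>2" using True by (intro mult_left_mono power_mono) auto
    finally show ?thesis using True by simp
  qed simp
  moreover have "length rest \<le> n" unfolding rest_def n_def by (rule length_filter_le)
  moreover have "T_parts (j # js) = (n * 2 + 1) + (n + 1) + (n * 2 + 1) + (n * 2 + 1) +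
      (length rest + 1) + (n + 1) + (if length rest < n then T_parts rest else 0) + 1"
    unfolding T_parts.simps Let_def rest_def[symmetric] n_def[symmetric]
    by (simp only: T_map_const T_filter_const T_min_list T_length length_map n_def[symmetric] one_add_one)
  ultimately show ?case unfolding n_def[symmetric] by (simp add: power2_eq_square)
qed simp

lemma one_piece_length: "one_piece m js ss \<Longrightarrow> length ss = length js"
  unfolding one_piece_def by (metis length_map size_mset)

text \<open>Provides, for every part at once, what the analysis of \<open>cl\<close> assumes of a
  clique instance.\<close>

lemma parts_member:
  assumes "valid_instance js" "(T, jl) \<in> set (parts js)"
  shows "valid_instance (map (halve T) jl) \<and> map (halve T) jl \<noteq> [] \<and>
     min_list (map deadline (map (halve T) jl)) = T \<and>
     (\<forall>j\<in>set (map (halve T) jl). release j \<le> T) \<and> length jl \<le> length js"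
  using assms
proof (induction "length js" arbitrary: js rule: less_induct)
  case less
  show ?case
  proof (cases "js = []")
    case False
    note valid = less.prems(1)
    define T' where "T' = min_list (map deadline js)"
    define part where "part = filter (\<lambda>x. release x \<le> T') js"
    define rest where "rest = filter (\<lambda>x. T' < release x) js"
    have short: "length rest < length js"
      by (rule rest_shorter[OF valid False, folded T'_def, folded part_def rest_def])
    have "(T, jl) = (T', part) \<or> (T, jl) \<in> set (parts rest)"
      using less.prems(2) unfolding parts_rec[OF valid False, folded T'_def, folded part_def rest_def] by simp
    thus ?thesis
    proof
      assume "(T, jl) = (T', part)"
      hence eq: "T = T'" "jl = part" by auto
      have "length part \<le> length js" unfolding part_def by (rule length_filter_le)
      thus ?thesis
        unfolding eq using halve_part[OF valid False, folded T'_def, folded part_def rest_def] by blast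
    next
      assume mem: "(T, jl) \<in> set (parts rest)"
      have "valid_instance rest" unfolding rest_def by (rule valid_instance_filter[OF valid])
      from less.hyps[OF short this mem] short show ?thesis by linarith
    qed
  qed (use less.prems in simp)
qed

lemma length_parts_le: "valid_instance js \<Longrightarrow> length (parts js) \<le> length js"
proof (induction "length js" arbitrary: js rule: less_induct)
  case less
  show ?case
  proof (cases "js = []")
    case False
    note valid = less.prems(1)
    define T where "T = min_list (map deadline js)"
    define rest where "rest = filter (\<lambda>x. T < release x) js"
    have "length rest < length js"
      by (rule rest_shorter[OF valid False, folded T_def, folded rest_def])
    moreover have "valid_instance rest" unfolding rest_def by (rule valid_instance_filter[OF valid])
    ultimately show ?thesis
      using less.hyps[of rest] unfolding parts_rec[OF valid False, folded T_def, folded rest_def] by simp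
  qed simp
qed

context
  fixes \<alpha> :: real and opt :: "nat \<Rightarrow> job list \<Rightarrow> segment list" and m :: nat
    and T_opt :: "nat \<Rightarrow> job list \<Rightarrow> nat" and q n :: nat
  assumes \<alpha>: "1 < \<alpha>" and m: "1 \<le> m"
    and opt: "\<And>js. valid_instance js \<Longrightarrow>
           wf_segments m (opt m js) \<and> optimal_preemptive \<alpha> m js (schedule_of (opt m js))"
    and T_opt_le: "\<And>js. valid_instance js \<Longrightarrow> length js \<le> n \<Longrightarrow> T_opt m js \<le> q"
    and length_opt_le: "\<And>js. valid_instance js \<Longrightarrow> length js \<le> n \<Longrightarrow> length (opt m js) \<le> q"
begin

lemma T_cl_le:
  assumes valid: "valid_instance js" and "js \<noteq> []" and len: "length js \<le> n"
    and clique: "\<And>j. j \<in> set js \<Longrightarrow> release j \<le> min_list (map deadline js)"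
  shows "T_cl opt T_opt m js \<le> cl_bound q n" "length (cl opt m js) = length js"
proof -
  note cl = cl_correct[where opt = opt, OF \<alpha> m opt valid \<open>js \<noteq> []\<close> clique]
  show l: "length (cl opt m js) = length js" by (rule one_piece_length[OF cl(3)])
  define T where "T = min_list (map deadline js)"
  define L where "L = filter (\<lambda>j. exec_before T (opt m js) (jid j) \<ge> exec_after T (opt m js) (jid j)) js"
  define R where "R = filter (\<lambda>j. exec_before T (opt m js) (jid j) < exec_after T (opt m js) (jid j)) js"
  have LR: "length L \<le> n" "length R \<le> n"
    using len length_filter_le[of _ js] order.trans unfolding L_def R_def by blast+
  have valid': "valid_instance (map (with_deadline T) L)" "valid_instance (map (with_release T) R)"
    using cl(1,2) unfolding L_def R_def T_def by blast+
  have "cl opt m js = cd opt m T (map (with_deadline T) L) @ crd opt m T (map (with_release T) R)"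
    by (simp add: cl_def Let_def L_def R_def T_def)
  \<comment> \<open>The output of \<open>cl\<close> has one piece per job, which bounds the list
    traversed by the final append.\<close>
  hence cd: "length (cd opt m T (map (with_deadline T) L)) \<le> n" using l len by simp
  have q: "length (opt m js) \<le> q" "T_opt m js \<le> q" using length_opt_le T_opt_le valid len by auto
  define F where "F = n * (2 * (3 * q + 2) + 1) + 1"
  have filter: "T_filter (\<lambda>_. 2 * T_exec (opt m js)) js \<le> F"
    unfolding F_def T_filter_const T_exec using q len by (intro add_mono mult_mono) auto
  have cd_le: "T_cd opt T_opt m T (map (with_deadline T) L) \<le> list_bound q n"
    using LR valid' T_opt_le length_opt_le by (intro T_cd_le) auto
  have crd_le: "T_crd opt T_opt m T (map (with_release T) R) \<le> list_bound q n"
    using LR valid' T_opt_le length_opt_le by (intro T_crd_le) auto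
  have cl_eq: "T_cl opt T_opt m js = T_opt m js + (length js * 2 + 1) + (length js + 1) +
      T_filter (\<lambda>_. 2 * T_exec (opt m js)) js + T_filter (\<lambda>_. 2 * T_exec (opt m js)) js +
      (length L * 2 + 1) + (length R * 2 + 1) +
      T_cd opt T_opt m T (map (with_deadline T) L) + T_crd opt T_opt m T (map (with_release T) R) +
      (length (cd opt m T (map (with_deadline T) L)) + 1)"
    unfolding T_cl_def Let_def T_def[symmetric] L_def[symmetric] R_def[symmetric]
    by (simp only: T_map_const T_min_list T_append length_map one_add_one)
  have "cl_bound q n = q + (n * 2 + 1) + (n + 1) + F + F + (n * 2 + 1) + (n * 2 + 1) +
      list_bound q n + list_bound q n + (n + 1)"
    unfolding cl_bound_def F_def[symmetric] by simp
  thus "T_cl opt T_opt m js \<le> cl_bound q n"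
    unfolding cl_eq using q filter cd_le crd_le cd LR len by simp
qed

text \<open>A coarse count suffices: there are at most \<open>n\<close> parts, and each is charged
  as if it had \<open>n\<close> jobs.\<close>

lemma T_agr_le:
  assumes valid: "valid_instance js" and agr: "agreeable js" and len: "length js \<le> n"
  shows "T_agr opt T_opt m js \<le> agr_bound q n" "length (agr opt m js) \<le> T_agr opt T_opt m js"
proof -
  have l: "length (agr opt m js) = length js"
    using agr_one_piece[where opt = opt, OF \<alpha> m opt valid agr] one_piece_length by blast
  have concat: "T_concat (map (\<lambda>(T, jl). cl opt m (map (halve T) jl)) (parts js)) =
      length js + 2 * length (parts js) + 1"
    using l by (simp add: T_concat agr_def)
  thus "length (agr opt m js) \<le> T_agr opt T_opt m js"
    using l by (simp add: T_agr_def)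
  have pl: "length (parts js) \<le> n" using length_parts_le[OF valid] len by simp
  have "T_map (\<lambda>_. 1) jl + T_cl opt T_opt m (map (halve T) jl) \<le> n * 2 + 1 + cl_bound q n"
    if "(T, jl) \<in> set (parts js)" for T jl
  proof -
    note pm = parts_member[OF valid that]
    have "T_cl opt T_opt m (map (halve T) jl) \<le> cl_bound q n"
      by (rule T_cl_le) (use pm len in auto)
    thus ?thesis using pm len by (simp add: T_map_const)
  qed
  hence "(\<Sum>(T, jl)\<leftarrow>parts js. T_map (\<lambda>_. 1) jl + T_cl opt T_opt m (map (halve T) jl)) \<le>
      (\<Sum>_\<leftarrow>parts js. n * 2 + 1 + cl_bound q n)"
    by (intro sum_list_mono) auto
  also have "\<dots> = length (parts js) * (n * 2 + 1 + cl_bound q n)" by (simp add: sum_list_triv)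
  also have "\<dots> \<le> n * (n * 2 + 1 + cl_bound q n)" using pl by (intro mult_right_mono) auto
  finally have "T_map (\<lambda>(T, jl). T_map (\<lambda>_. 1) jl + T_cl opt T_opt m (map (halve T) jl)) (parts js)
      \<le> n * (n * 2 + 1 + cl_bound q n) + n + 1"
    unfolding T_map[of _ "parts js"] using pl by linarith
  moreover have "T_parts js \<le> 10 * (n + 1)\<^sup>2"
    using T_parts_le[of js] len by (meson add_le_mono1 mult_le_mono2 order.trans power_mono zero_le)
  moreover have "T_concat (map (\<lambda>(T, jl). cl opt m (map (halve T) jl)) (parts js)) \<le> n + 2 * n + 1"
    unfolding concat using pl len by simp
  ultimately show "T_agr opt T_opt m js \<le> agr_bound q n"
    unfolding T_agr_def agr_bound_def by (intro add_mono)
qed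

end

lemma agr_polynomial_time:
  assumes \<alpha>: "1 < \<alpha>"
    and opt: "\<And>m js. m \<ge> 1 \<Longrightarrow> valid_instance js \<Longrightarrow>
           wf_segments m (opt m js) \<and> optimal_preemptive \<alpha> m js (schedule_of (opt m js))"
    and poly: "polynomial_time (\<lambda>_. True) opt T_opt"
  shows "polynomial_time agreeable (agr opt) (T_agr opt T_opt)"
proof -
  obtain p :: "nat poly" where p: "\<And>(m :: nat) js. 1 \<le> m \<Longrightarrow> valid_instance js \<Longrightarrow>
      length (opt m js) \<le> T_opt m js \<and> T_opt m js \<le> poly p (input_size m js)"
    using poly unfolding polynomial_time_def by blast
  show ?thesis
    unfolding polynomial_time_def
  \<comment> \<open>\<open>[:0, 1:]\<close> is the polynomial of the identity, so the value of this
    witness at \<open>N\<close> is \<open>agr_bound (poly p N) N\<close>.\<close>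
  proof (intro exI[of _ "agr_bound p [:0, 1:]"] allI impI)
    fix m :: nat and js assume m: "1 \<le> m" and js: "valid_instance js \<and> agreeable js"
    define N where "N = input_size m js"
    have bound: "T_opt m js' \<le> poly p N" "length (opt m js') \<le> poly p N"
      if "valid_instance js'" "length js' \<le> length js" for js'
    proof -
      \<comment> \<open>All calls of \<open>opt\<close> keep \<open>m\<close> and have at most as
        many jobs as \<open>js\<close>, so one value of \<open>p\<close> bounds each of
        them.\<close>
      have "poly p (input_size m js') \<le> poly p N"
        using that by (intro poly_mono_nat) (simp add: N_def input_size_def)
      thus "T_opt m js' \<le> poly p N" "length (opt m js') \<le> poly p N"
        using p[OF m that(1)] by auto
    qed
    note le = T_agr_le[where opt = opt and T_opt = T_opt and js = js and n = "length js", OF \<alpha> m opt[OF m] bound]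
    have "agr_bound (poly p N) (length js) \<le> agr_bound (poly p N) N"
      unfolding agr_bound_def cl_bound_def list_bound_def
      by (intro add_mono mult_mono power_mono order.refl) (auto simp: N_def input_size_def)
    hence "T_agr opt T_opt m js \<le> poly (agr_bound p [:0, 1:]) N"
      using le(1) js by (simp add: poly_agr_bound)
    moreover have "length (agr opt m js) \<le> T_agr opt T_opt m js" using le(2) js by blast
    ultimately show "length (agr opt m js) \<le> T_agr opt T_opt m js \<and>
        T_agr opt T_opt m js \<le> poly (agr_bound p [:0, 1:]) (input_size m js)"
      by (simp add: N_def)
  qed
qed

section \<open>The approximation ratio\<close>

theorem theorem4:
  fixes \<alpha> :: real
    and opt :: "nat \<Rightarrow> job list \<Rightarrow> segment list"
    and T_opt :: "nat \<Rightarrow> job list \<Rightarrow> nat"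
  assumes "\<alpha> > 1"
    and "\<And>m js. m \<ge> 1 \<Longrightarrow> valid_instance js \<Longrightarrow>
           wf_segments m (opt m js) \<and> optimal_preemptive \<alpha> m js (schedule_of (opt m js))"
    and "polynomial_time (\<lambda>_. True) opt T_opt"
  shows "approximation_algorithm \<alpha> agreeable
           (\<lambda>m. (4 * (2 - 1 / real m)) powr (\<alpha> - 1)) (agr opt) (T_agr opt T_opt)"
  unfolding approximation_algorithm_def
proof (intro conjI allI impI)
  show "polynomial_time agreeable (agr opt) (T_agr opt T_opt)"
    using assms by (rule agr_polynomial_time)
next
  fix m :: nat and js assume m: "1 \<le> m" and js: "valid_instance js \<and> agreeable js"
  hence valid: "valid_instance js" and agr: "agreeable js" by auto
  note opt = assms(2)[OF m]
  have op: "one_piece m js (agr opt m js)"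
    using agr_one_piece[where opt = opt, OF assms(1) m opt valid agr] by blast
  show wf: "wf_segments m (agr opt m js)" using op unfolding one_piece_def by blast
  show "nonpreemptive_feasible m js (schedule_of (agr opt m js))"
    by (rule one_piece_nonpreemptive_feasible[OF op valid])
  define \<rho> where "\<rho> = (4 * (2 - 1 / real m)) powr (\<alpha> - 1)"
  have "1 / real m \<le> 1" using m by simp
  hence \<rho>: "0 < \<rho>" by (simp add: \<rho>_def)
  have le: "ennreal (seg_energy \<alpha> (agr opt m js)) \<le> ennreal \<rho> * energy \<alpha> m S"
    if "nonpreemptive_feasible m js S" for S
  proof -
    \<comment> \<open>A non-preemptive schedule is in particular a preemptive one, so it may be
      compared with the preemptive optima of the parts.\<close>
    have S: "preemptive_feasible m js S" using that by (simp add: nonpreemptive_feasible_def)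
    have "ennreal (seg_energy \<alpha> (agr opt m js)) \<le> ennreal \<rho> * partial_energy \<alpha> m S (jid ` set js)"
      unfolding \<rho>_def by (rule agr_energy[where opt = opt, OF assms(1) m opt S valid valid]) auto
    also have "\<dots> \<le> ennreal \<rho> * energy \<alpha> m S"
      by (intro mult_left_mono partial_energy_le_energy) auto
    finally show ?thesis .
  qed
  \<comment> \<open>Dividing by the positive constant \<open>\<rho>\<close> turns the claim into a
    lower bound for the infimum, which is checked schedule by schedule and multiplied back
    afterwards.\<close>
  have "ennreal (1 / \<rho>) * ennreal (seg_energy \<alpha> (agr opt m js)) \<le> nonpreemptive_opt \<alpha> m js"
    unfolding nonpreemptive_opt_def
  proof (rule INF_greatest)
    fix S assume "S \<in> {S. nonpreemptive_feasible m js S}"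
    hence "ennreal (1 / \<rho>) * ennreal (seg_energy \<alpha> (agr opt m js)) \<le> ennreal (1 / \<rho>) * (ennreal \<rho> * energy \<alpha> m S)"
      using le by (intro mult_left_mono) auto
    also have "\<dots> = energy \<alpha> m S"
      using \<rho> by (simp add: mult.assoc[symmetric] ennreal_mult[symmetric])
    finally show "ennreal (1 / \<rho>) * ennreal (seg_energy \<alpha> (agr opt m js)) \<le> energy \<alpha> m S" .
  qed
  hence "ennreal \<rho> * (ennreal (1 / \<rho>) * ennreal (seg_energy \<alpha> (agr opt m js))) \<le> ennreal \<rho> * nonpreemptive_opt \<alpha> m js"
    by (intro mult_left_mono) auto
  also have "ennreal \<rho> * (ennreal (1 / \<rho>) * ennreal (seg_energy \<alpha> (agr opt m js))) = energy \<alpha> m (schedule_of (agr opt m js))"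
    using \<rho> by (simp add: mult.assoc[symmetric] ennreal_mult[symmetric] energy_schedule_of[OF wf])
  finally show "energy \<alpha> m (schedule_of (agr opt m js)) \<le>
      ennreal ((4 * (2 - 1 / real m)) powr (\<alpha> - 1)) * nonpreemptive_opt \<alpha> m js"
    by (simp add: \<rho>_def)
qed

end
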